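(* Let $\mathcal{C}$ be a hereditary class of finite ordered binary structures of type $k$. Then either there is an integer $\ell$ such that every member of $\mathcal{C}$ has a monomorphic decomposition into at most $\ell+1$ blocks, in which case $\mathcal{C}$ is a finite union of ages of ordered binary structures of type $k$, each having a monomorphic decomposition into at most $\ell+1$ blocks, and the profile of $\mathcal{C}$ coincides for all sufficiently large $n$ with a polynomial; or the profile of $\mathcal{C}$ is at least exponential, i.e. there exist $a>0$, $c>1$ with $\varphi_{\mathcal{C}}(n)\ge ac^n$ for all sufficiently large $n$.
   Context: An ordered binary structure of type $k$ is $(E,\le,\rho_1,\dots,\rho_k)$ with $\le$ a linear order and $\rho_i$ binary relations on $E$. A class is hereditary if closed under isomorphism and restrictions. The profile $\varphi_{\mathcal{C}}(n)$ counts members of $\mathcal{C}$ with $n$ elements up to isomorphism. The age of a structure is the class of its finite restrictions up to isomorphism. A monomorphic decomposition of $\mathcal{R}$ is a partition $\mathcal{P}$ of $E$ such that for all finite $A,A'\subseteq E$ with $|A\cap B|=|A'\cap B|$ for every $B\in\mathcal{P}$, $\mathcal{R}_{\restriction A}\cong\mathcal{R}_{\restriction A'}$. *)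

theory Defs
  imports Complex_Main "HOL-Library.Disjoint_Sets" "HOL-Computational_Algebra.Polynomial"
begin

record 'a ordbin =
  elts :: "'a set"
  leq  :: "'a rel"
  rels :: "'a rel list"

definition ordered_binary_structure :: "nat \<Rightarrow> 'a ordbin \<Rightarrow> bool" where
  "ordered_binary_structure k R \<longleftrightarrow>
     linear_order_on (elts R) (leq R) \<and> length (rels R) = k \<and>
     (\<forall>r \<in> set (rels R). r \<subseteq> elts R \<times> elts R)"

definition restriction :: "'a ordbin \<Rightarrow> 'a set \<Rightarrow> 'a ordbin" where
  "restriction R A =
     \<lparr>elts = elts R \<inter> A,
      leq = leq R \<inter> A \<times> A,
      rels = map (\<lambda>r. r \<inter> A \<times> A) (rels R)\<rparr>"

definition isomorphic :: "'a ordbin \<Rightarrow> 'b ordbin \<Rightarrow> bool" where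
  "isomorphic R S \<longleftrightarrow> length (rels R) = length (rels S) \<and>
     (\<exists>f. bij_betw f (elts R) (elts S) \<and>
       (\<forall>x \<in> elts R. \<forall>y \<in> elts R. (x, y) \<in> leq R \<longleftrightarrow> (f x, f y) \<in> leq S) \<and>
       (\<forall>i < length (rels R). \<forall>x \<in> elts R. \<forall>y \<in> elts R.
          (x, y) \<in> rels R ! i \<longleftrightarrow> (f x, f y) \<in> rels S ! i))"

text \<open>
  A class of finite structures is represented by its members whose elements are natural
  numbers. Every countable structure is isomorphic to one of these, so a class of finite
  structures that is closed under isomorphism is determined by them.
\<close>

definition hereditary_class :: "nat \<Rightarrow> nat ordbin set \<Rightarrow> bool" where
  "hereditary_class k C \<longleftrightarrow>
     (\<forall>R \<in> C. ordered_binary_structure k R \<and> finite (elts R)) \<and>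
     (\<forall>R \<in> C. \<forall>S. ordered_binary_structure k S \<and> isomorphic R S \<longrightarrow> S \<in> C) \<and>
     (\<forall>R \<in> C. \<forall>A \<subseteq> elts R. restriction R A \<in> C)"

text \<open>
  The profile counts isomorphism classes. For a fixed type there are finitely many of them
  on \<open>n\<close> elements, so \<open>card\<close> is applied to a finite set.
\<close>

definition profile :: "nat ordbin set \<Rightarrow> nat \<Rightarrow> nat" where
  "profile C n =
     (let M = {R \<in> C. finite (elts R) \<and> card (elts R) = n}
      in card (M // {(R, S). R \<in> M \<and> S \<in> M \<and> isomorphic R S}))"

definition age :: "nat \<Rightarrow> nat ordbin \<Rightarrow> nat ordbin set" where
  "age k R = {S. ordered_binary_structure k S \<and>
     (\<exists>A \<subseteq> elts R. finite A \<and> isomorphic (restriction R A) S)}"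

definition monomorphic_decomposition :: "'a ordbin \<Rightarrow> 'a set set \<Rightarrow> bool" where
  "monomorphic_decomposition R P \<longleftrightarrow> partition_on (elts R) P \<and>
     (\<forall>A A'. finite A \<and> A \<subseteq> elts R \<and> finite A' \<and> A' \<subseteq> elts R \<and>
        (\<forall>B \<in> P. card (A \<inter> B) = card (A' \<inter> B)) \<longrightarrow>
        isomorphic (restriction R A) (restriction R A'))"

definition has_monomorphic_decomposition_le :: "'a ordbin \<Rightarrow> nat \<Rightarrow> bool" where
  "has_monomorphic_decomposition_le R m \<longleftrightarrow>
     (\<exists>P. monomorphic_decomposition R P \<and> finite P \<and> card P \<le> m)"

definition eventually_polynomial :: "(nat \<Rightarrow> nat) \<Rightarrow> bool" where
  "eventually_polynomial f \<longleftrightarrow>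
     (\<exists>p :: real poly. \<forall>\<^sub>F n in sequentially. real (f n) = poly p (real n))"

definition at_least_exponential :: "(nat \<Rightarrow> nat) \<Rightarrow> bool" where
  "at_least_exponential f \<longleftrightarrow>
     (\<exists>a c :: real. a > 0 \<and> c > 1 \<and> (\<forall>\<^sub>F n in sequentially. real (f n) \<ge> a * c ^ n))"

end

theory Submission
  imports Defs "HOL-Library.FuncSet" "HOL-Library.Nat_Bijection" "HOL-Library.Extended_Nat"
begin

text \<open>
  A finite ordered structure has a unique isomorphic copy on an initial segment of the natural
  numbers, so the profile counts these copies. Call a position \<open>x\<close> bad if exchanging \<open>x\<close> and
  \<open>x + 1\<close> is noticed by a loop or by a third element. The bad positions cut the structure into
  intervals; which relations hold between two points depends only on their intervals and on their
  order, so the intervals form a monomorphic decomposition.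

  If the number of bad positions is unbounded in the class, choose many disjoint bad pairs whose
  witnesses avoid all the chosen pairs. Keeping one point of each pair and all the witnesses gives
  \<open>2 ^ m\<close> pairwise non-isomorphic restrictions of the same size, hence exponential growth. A
  decomposition into at most \<open>l + 1\<close> blocks allows only polynomially many restrictions, so bounded
  decompositions force a bounded number of bad positions.

  In the bounded case finitely many templates suffice, and a member is given by a template and the
  vector of its interval lengths. The vectors occurring for a template form a downset, which by
  Dickson's lemma is a finite union of boxes; each box gives an age, and the bound on the number of
  blocks passes to the infinite structure by compactness. Members with a canonical template
  correspond to differences of downsets, and counting the points of a downset by their coordinate
  sum gives an eventually polynomial function.
\<close>

section \<open>Isomorphism and colourings\<close>

text \<open>In the exponential part the obstacle is that the witness of one bad pair may be a point
  of another chosen pair and would then move with the choice made there. Reading "the choice of one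
  pair disturbs another" as arcs gives a digraph of out-degree at most 3, and such a digraph has an
  independent set of linear size. The blocks of a given monomorphic decomposition need not be
  intervals (any partition of a bare chain is monomorphic), so bad positions cannot be bounded by
  looking at its blocks; the bound \<open>L\<close> comes from counting and may be much larger than
  \<open>l\<close>. The infinite structures are built from the intervals of templates, so their
  number of blocks is first controlled by \<open>L\<close> only. This is why \<open>l + 1\<close>
  has to be recovered from their finite restrictions. One structure may come from several pairs of
  template and vector. That does no harm to a union of ages but spoils a count, hence the canonical
  pairs, which are unique. Their conditions are chosen to be stable under growing the blocks: only
  then do the non-canonical vectors form a downset that can be subtracted.\<close>

lemma isomorphic_refl [simp]: "isomorphic R R"
  unfolding isomorphic_def by (intro conjI exI[of _ id]) auto

lemma isomorphic_sym: "isomorphic R S \<Longrightarrow> isomorphic S R"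
  unfolding isomorphic_def
proof (elim conjE exE, intro conjI, simp)
  fix f
  assume len: "length (rels R) = length (rels S)"
    and f: "bij_betw f (elts R) (elts S)"
    and le: "\<forall>x\<in>elts R. \<forall>y\<in>elts R. ((x, y) \<in> leq R) = ((f x, f y) \<in> leq S)"
    and re: "\<forall>i<length (rels R). \<forall>x\<in>elts R. \<forall>y\<in>elts R.
               ((x, y) \<in> rels R ! i) = ((f x, f y) \<in> rels S ! i)"
  let ?g = "inv_into (elts R) f"
  have g: "bij_betw ?g (elts S) (elts R)"
    using f by (rule bij_betw_inv_into)
  have fg: "f (?g y) = y" and gin: "?g y \<in> elts R" if "y \<in> elts S" for y
    using f g that by (auto simp: bij_betw_inv_into_right bij_betwE)
  show "\<exists>f. bij_betw f (elts S) (elts R) \<and>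
        (\<forall>x\<in>elts S. \<forall>y\<in>elts S. ((x, y) \<in> leq S) = ((f x, f y) \<in> leq R)) \<and>
        (\<forall>i<length (rels S). \<forall>x\<in>elts S. \<forall>y\<in>elts S.
            ((x, y) \<in> rels S ! i) = ((f x, f y) \<in> rels R ! i))"
    by (intro exI[of _ ?g] conjI g) (use le re len in \<open>auto simp: fg gin\<close>)
qed

lemma isomorphic_trans: "isomorphic R S \<Longrightarrow> isomorphic S T \<Longrightarrow> isomorphic R T"
  unfolding isomorphic_def
proof (elim conjE exE, intro conjI, simp)
  fix f g
  assume "length (rels R) = length (rels S)" "length (rels S) = length (rels T)"
    and f: "bij_betw f (elts R) (elts S)" and g: "bij_betw g (elts S) (elts T)"
    and "\<forall>x\<in>elts R. \<forall>y\<in>elts R. ((x, y) \<in> leq R) = ((f x, f y) \<in> leq S)"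
    and "\<forall>x\<in>elts S. \<forall>y\<in>elts S. ((x, y) \<in> leq S) = ((g x, g y) \<in> leq T)"
    and "\<forall>i<length (rels R). \<forall>x\<in>elts R. \<forall>y\<in>elts R.
            ((x, y) \<in> rels R ! i) = ((f x, f y) \<in> rels S ! i)"
    and "\<forall>i<length (rels S). \<forall>x\<in>elts S. \<forall>y\<in>elts S.
            ((x, y) \<in> rels S ! i) = ((g x, g y) \<in> rels T ! i)"
  moreover have "f x \<in> elts S" if "x \<in> elts R" for x
    using f that by (auto simp: bij_betwE)
  ultimately show "\<exists>f. bij_betw f (elts R) (elts T) \<and>
        (\<forall>x\<in>elts R. \<forall>y\<in>elts R. ((x, y) \<in> leq R) = ((f x, f y) \<in> leq T)) \<and>
        (\<forall>i<length (rels R). \<forall>x\<in>elts R. \<forall>y\<in>elts R.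
            ((x, y) \<in> rels R ! i) = ((f x, f y) \<in> rels T ! i))"
    by (intro exI[of _ "g \<circ> f"] conjI bij_betw_trans[OF f g]) auto
qed

lemma elts_restriction [simp]: "elts (restriction R A) = elts R \<inter> A"
  and leq_restriction [simp]: "leq (restriction R A) = leq R \<inter> A \<times> A"
  and rels_restriction [simp]: "rels (restriction R A) = map (\<lambda>r. r \<inter> A \<times> A) (rels R)"
  by (simp_all add: restriction_def)

lemma restriction_restriction [simp]:
  "restriction (restriction R A) B = restriction R (A \<inter> B)"
  by (auto simp: restriction_def)

text \<open>A single map \<open>f\<close> serves all subsets \<open>A\<close> at once, which is what
  transporting a colouring along an isomorphism requires.\<close>

lemma isomorphic_restrictionE:
  assumes "isomorphic R S"
  obtains f where "bij_betw f (elts R) (elts S)"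
    and "\<And>A. A \<subseteq> elts R \<Longrightarrow> isomorphic (restriction R A) (restriction S (f ` A))"
proof -
  from assms obtain f where len: "length (rels R) = length (rels S)"
    and f: "bij_betw f (elts R) (elts S)"
    and le: "\<forall>x\<in>elts R. \<forall>y\<in>elts R. ((x, y) \<in> leq R) = ((f x, f y) \<in> leq S)"
    and re: "\<forall>i<length (rels R). \<forall>x\<in>elts R. \<forall>y\<in>elts R.
               ((x, y) \<in> rels R ! i) = ((f x, f y) \<in> rels S ! i)"
    unfolding isomorphic_def by auto
  have "isomorphic (restriction R A) (restriction S (f ` A))" if A: "A \<subseteq> elts R" for A
  proof -
    have eq: "elts R \<inter> A = A" "elts S \<inter> f ` A = f ` A"
      using A f by (auto simp: bij_betw_def)
    have "bij_betw f A (f ` A)"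
      using A f by (meson bij_betw_subset subset_refl)
    then show ?thesis
      unfolding isomorphic_def using len le re A
      by (intro conjI exI[of _ f]) (auto simp: eq subset_iff)
  qed
  with f that show thesis by blast
qed

lemma ordered_binary_structure_restriction:
  "ordered_binary_structure k R \<Longrightarrow> ordered_binary_structure k (restriction R A)"
  unfolding ordered_binary_structure_def order_on_defs
  by (auto simp: refl_on_def trans_def antisym_def total_on_def)

text \<open>A decomposition into at most \<open>m\<close> blocks is a colouring by \<open>m\<close> colours, some of them possibly
  unused.\<close>

definition monomorphic_coloring :: "'a ordbin \<Rightarrow> ('a \<Rightarrow> nat) \<Rightarrow> bool" where
  "monomorphic_coloring R f \<longleftrightarrow>
     (\<forall>A A'. finite A \<and> A \<subseteq> elts R \<and> finite A' \<and> A' \<subseteq> elts R \<and>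
        (\<forall>i. card {a \<in> A. f a = i} = card {a \<in> A'. f a = i}) \<longrightarrow>
        isomorphic (restriction R A) (restriction R A'))"

lemma has_monomorphic_decomposition_le_iff:
  "has_monomorphic_decomposition_le R m \<longleftrightarrow>
     (\<exists>f. f ` elts R \<subseteq> {..<m} \<and> monomorphic_coloring R f)"
proof
  assume "has_monomorphic_decomposition_le R m"
  then obtain P where P: "partition_on (elts R) P" "finite P" "card P \<le> m"
    and iso: "\<And>A A'. finite A \<Longrightarrow> A \<subseteq> elts R \<Longrightarrow> finite A' \<Longrightarrow> A' \<subseteq> elts R \<Longrightarrow>
        (\<forall>B \<in> P. card (A \<inter> B) = card (A' \<inter> B)) \<Longrightarrow>
        isomorphic (restriction R A) (restriction R A')"
    unfolding has_monomorphic_decomposition_le_def monomorphic_decomposition_def by metis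
  obtain g where g: "inj_on g P" "g ` P \<subseteq> {..<m}"
    using P card_le_inj[of P "{..<m}"] by auto
  define f where "f x = g (THE B. B \<in> P \<and> x \<in> B)" for x
  have the: "(THE B. B \<in> P \<and> x \<in> B) = B" if "B \<in> P" "x \<in> B" for x B
    using that P by (intro the_equality) (auto simp: partition_on_def disjoint_def)
  have f: "f x = g B" if "B \<in> P" "x \<in> B" for x B
    using the[OF that] by (simp add: f_def)
  have cover: "\<exists>B\<in>P. x \<in> B" if "x \<in> elts R" for x
    using P that by (auto simp: partition_on_def)
  have trace: "{a \<in> A. f a = g B} = A \<inter> B" if "A \<subseteq> elts R" "B \<in> P" for A B
  proof (intro set_eqI iffI)
    fix a assume a: "a \<in> {a \<in> A. f a = g B}"
    then obtain B' where B': "B' \<in> P" "a \<in> B'" using cover \<open>A \<subseteq> elts R\<close> by blast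
    with f[OF B'] a g \<open>B \<in> P\<close> have "B' = B" by (simp add: inj_on_def)
    with a B' show "a \<in> A \<inter> B" by simp
  qed (use f that in auto)
  show "\<exists>f. f ` elts R \<subseteq> {..<m} \<and> monomorphic_coloring R f"
  proof (intro exI[of _ f] conjI)
    show "f ` elts R \<subseteq> {..<m}"
    proof clarify
      fix x assume "x \<in> elts R"
      then obtain B where "B \<in> P" "x \<in> B" using cover by blast
      with f g show "f x < m" by auto
    qed
    show "monomorphic_coloring R f"
      unfolding monomorphic_coloring_def
      by (intro allI impI iso) (auto simp flip: trace)
  qed
next
  assume "\<exists>f. f ` elts R \<subseteq> {..<m} \<and> monomorphic_coloring R f"
  then obtain f where f: "f ` elts R \<subseteq> {..<m}" and iso: "monomorphic_coloring R f" by auto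
  \<comment> \<open>Only colours that occur are taken, because \<open>partition_on\<close> forbids
    empty blocks.\<close>
  define P where "P = (\<lambda>i. {x \<in> elts R. f x = i}) ` f ` elts R"
  have fin: "finite (f ` elts R)" and "card (f ` elts R) \<le> m"
    using f finite_subset card_mono[OF _ f] by auto
  then have "finite P" "card P \<le> m"
    unfolding P_def using card_image_le[OF fin] order_trans by auto
  moreover have "partition_on (elts R) P"
    by (auto simp: partition_on_def disjoint_def P_def)
  moreover have "isomorphic (restriction R A) (restriction R A')"
    if A: "finite A" "A \<subseteq> elts R" "finite A'" "A' \<subseteq> elts R"
      and eq: "\<forall>B\<in>P. card (A \<inter> B) = card (A' \<inter> B)" for A A'
  proof -
    have "card {a \<in> A. f a = i} = card {a \<in> A'. f a = i}" for i
    proof (cases "i \<in> f ` elts R")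
      case True
      then have "card (A \<inter> {x \<in> elts R. f x = i}) = card (A' \<inter> {x \<in> elts R. f x = i})"
        using eq by (auto simp: P_def)
      moreover have "A \<inter> {x \<in> elts R. f x = i} = {a \<in> A. f a = i}"
        "A' \<inter> {x \<in> elts R. f x = i} = {a \<in> A'. f a = i}"
        using A by auto
      ultimately show ?thesis by simp
    next
      case False
      then have "{a \<in> A. f a = i} = {}" "{a \<in> A'. f a = i} = {}"
        using A by auto
      then show ?thesis by (simp only:)
    qed
    with A iso show ?thesis
      unfolding monomorphic_coloring_def by blast
  qed
  ultimately show "has_monomorphic_decomposition_le R m"
    unfolding has_monomorphic_decomposition_le_def monomorphic_decomposition_def by metis
qed

lemma has_monomorphic_decomposition_le_isomorphic:
  assumes "isomorphic R S" "has_monomorphic_decomposition_le R m"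
  shows "has_monomorphic_decomposition_le S m"
proof -
  obtain f where f: "f ` elts R \<subseteq> {..<m}" and mono: "monomorphic_coloring R f"
    using assms(2) unfolding has_monomorphic_decomposition_le_iff by auto
  obtain h where h: "bij_betw h (elts S) (elts R)"
    and iso: "\<And>A. A \<subseteq> elts S \<Longrightarrow> isomorphic (restriction S A) (restriction R (h ` A))"
    using isomorphic_restrictionE[OF isomorphic_sym[OF assms(1)]] by metis
  have inj: "inj_on h A" if "A \<subseteq> elts S" for A
    using h that by (auto simp: bij_betw_def intro: inj_on_subset)
  have count: "card {b \<in> h ` A. f b = i} = card {a \<in> A. f (h a) = i}" if "A \<subseteq> elts S" for A i
  proof -
    have "{b \<in> h ` A. f b = i} = h ` {a \<in> A. f (h a) = i}" by auto
    then show ?thesis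
      using inj[of "{a \<in> A. f (h a) = i}"] that by (simp add: card_image subset_iff)
  qed
  have "monomorphic_coloring S (\<lambda>a. f (h a))"
    unfolding monomorphic_coloring_def
  proof (intro allI impI, elim conjE)
    fix A A' assume A: "finite A" "A \<subseteq> elts S" "finite A'" "A' \<subseteq> elts S"
      "\<forall>i. card {a \<in> A. f (h a) = i} = card {a \<in> A'. f (h a) = i}"
    have "h ` A \<subseteq> elts R" "h ` A' \<subseteq> elts R"
      using A h image_mono[of _ "elts S" h] by (auto simp: bij_betw_def)
    then have "isomorphic (restriction R (h ` A)) (restriction R (h ` A'))"
      using A mono unfolding monomorphic_coloring_def by (simp add: count)
    then show "isomorphic (restriction S A) (restriction S A')"
      using iso A isomorphic_trans isomorphic_sym by metis
  qed
  moreover have "(\<lambda>a. f (h a)) ` elts S \<subseteq> {..<m}"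
    using f h by (auto simp: bij_betw_def)
  ultimately show ?thesis
    unfolding has_monomorphic_decomposition_le_iff by blast
qed

section \<open>Structures on initial segments of the natural numbers\<close>

definition std :: "nat \<Rightarrow> nat rel list \<Rightarrow> nat ordbin" where
  "std n \<rho> = \<lparr>elts = {..<n}, leq = {(x, y). x \<le> y \<and> y < n}, rels = \<rho>\<rparr>"

lemma std_simps [simp]:
  "elts (std n \<rho>) = {..<n}" "leq (std n \<rho>) = {(x, y). x \<le> y \<and> y < n}" "rels (std n \<rho>) = \<rho>"
  by (simp_all add: std_def)

lemma ordered_binary_structure_std_iff:
  "ordered_binary_structure k (std n \<rho>) \<longleftrightarrow>
     length \<rho> = k \<and> (\<forall>r \<in> set \<rho>. r \<subseteq> {..<n} \<times> {..<n})"
  unfolding ordered_binary_structure_def order_on_defs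
  by (auto simp: refl_on_def trans_def antisym_def total_on_def)

lemma isomorphic_stdI:
  assumes h: "bij_betw h {..<n} (elts R)" and len: "length \<rho> = length (rels R)"
    and le: "\<And>x y. x < n \<Longrightarrow> y < n \<Longrightarrow> (h x, h y) \<in> leq R \<longleftrightarrow> x \<le> y"
    and re: "\<And>i x y. i < length \<rho> \<Longrightarrow> x < n \<Longrightarrow> y < n \<Longrightarrow>
               (x, y) \<in> \<rho> ! i \<longleftrightarrow> (h x, h y) \<in> rels R ! i"
  shows "isomorphic (std n \<rho>) R"
  unfolding isomorphic_def using assms by (intro conjI exI[of _ h]) auto

text \<open>The rank of a point, its number of strict predecessors, is strictly increasing and below
  \<open>card E\<close>; the enumeration is the inverse of the rank.\<close>

lemma finite_linear_order_enumeration: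
  assumes lin: "linear_order_on E r" and fin: "finite E"
  obtains h where "bij_betw h {..<card E} E"
    and "\<And>x y. x < card E \<Longrightarrow> y < card E \<Longrightarrow> (h x, h y) \<in> r \<longleftrightarrow> x \<le> y"
proof -
  have refl: "(x, x) \<in> r" if "x \<in> E" for x
    using lin that by (simp add: order_on_defs refl_on_def)
  have trans: "(x, z) \<in> r" if "(x, y) \<in> r" "(y, z) \<in> r" for x y z
    using lin that unfolding order_on_defs by (meson transD)
  have anti: "x = y" if "(x, y) \<in> r" "(y, x) \<in> r" for x y
    using lin that unfolding order_on_defs by (meson antisymD)
  have tot: "(x, y) \<in> r \<or> (y, x) \<in> r" if "x \<in> E" "y \<in> E" for x y
    using lin that refl[of x] by (cases "x = y") (auto simp: order_on_defs total_on_def)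
  define f where "f x = card {y \<in> E. (y, x) \<in> r \<and> y \<noteq> x}" for x
  have less: "f x < f y" if "x \<in> E" "y \<in> E" "(x, y) \<in> r" "x \<noteq> y" for x y
    unfolding f_def
  proof (rule psubset_card_mono)
    show "finite {z \<in> E. (z, y) \<in> r \<and> z \<noteq> y}" using fin by simp
    have "x \<in> {z \<in> E. (z, y) \<in> r \<and> z \<noteq> y}" using that by simp
    moreover have "x \<notin> {z \<in> E. (z, x) \<in> r \<and> z \<noteq> x}" by simp
    moreover have "{z \<in> E. (z, x) \<in> r \<and> z \<noteq> x} \<subseteq> {z \<in> E. (z, y) \<in> r \<and> z \<noteq> y}"
      using that trans anti by blast
    ultimately show "{z \<in> E. (z, x) \<in> r \<and> z \<noteq> x} \<subset> {z \<in> E. (z, y) \<in> r \<and> z \<noteq> y}"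
      by blast
  qed
  have le_iff: "(x, y) \<in> r \<longleftrightarrow> f x \<le> f y" if "x \<in> E" "y \<in> E" for x y
    using less[OF that] less[OF that(2,1)] tot[OF that] refl that
    by (cases "x = y") (auto simp: not_le[symmetric])
  have "inj_on f E"
    using less tot by (intro inj_onI) (metis less_irrefl)
  moreover have "f ` E \<subseteq> {..<card E}"
    unfolding f_def using fin by (auto intro!: psubset_card_mono)
  ultimately have bij: "bij_betw f E {..<card E}"
    unfolding bij_betw_def by (simp add: card_image card_subset_eq)
  let ?h = "inv_into E f"
  have "bij_betw ?h {..<card E} E"
    using bij by (rule bij_betw_inv_into)
  moreover have "(?h x, ?h y) \<in> r \<longleftrightarrow> x \<le> y" if "x < card E" "y < card E" for x y
    using that bij le_iff[of "?h x" "?h y"]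
      bij_betwE[OF bij_betw_inv_into[OF bij]]
    by (simp add: bij_betw_inv_into_right[OF bij])
  ultimately show thesis by (rule that)
qed

lemma isomorphic_std_exists:
  assumes R: "ordered_binary_structure k R" and fin: "finite (elts R)"
  obtains \<rho> where "isomorphic (std (card (elts R)) \<rho>) R"
    and "ordered_binary_structure k (std (card (elts R)) \<rho>)"
proof -
  let ?n = "card (elts R)"
  have "linear_order_on (elts R) (leq R)"
    using R by (simp add: ordered_binary_structure_def)
  then obtain h where h: "bij_betw h {..<?n} (elts R)"
    and le: "\<And>x y. x < ?n \<Longrightarrow> y < ?n \<Longrightarrow> (h x, h y) \<in> leq R \<longleftrightarrow> x \<le> y"
    using finite_linear_order_enumeration[OF _ fin] by metis
  define \<rho> where "\<rho> = map (\<lambda>r. {(x, y). x < ?n \<and> y < ?n \<and> (h x, h y) \<in> r}) (rels R)"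
  have "isomorphic (std ?n \<rho>) R"
    by (rule isomorphic_stdI[OF h _ le]) (auto simp: \<rho>_def)
  moreover have "ordered_binary_structure k (std ?n \<rho>)"
    using R unfolding ordered_binary_structure_std_iff
    by (auto simp: ordered_binary_structure_def \<rho>_def)
  ultimately show thesis by (rule that)
qed

text \<open>The points below \<open>x\<close> are mapped onto the points below \<open>f x\<close>;
  comparing cardinalities gives \<open>f x = x\<close>. This is the rigidity of finite
  chains.\<close>

lemma strict_mono_on_lessThan_id:
  fixes f :: "nat \<Rightarrow> nat"
  assumes bij: "bij_betw f {..<n} {..<n}"
    and mono: "\<And>x y. x < n \<Longrightarrow> y < n \<Longrightarrow> f x \<le> f y \<longleftrightarrow> x \<le> y" and "x < n"
  shows "f x = x"
proof -
  have f: "f y < n" if "y < n" for y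
    using bij that by (auto simp: bij_betw_def)
  have inj: "inj_on f {..<x}"
    using bij \<open>x < n\<close> by (auto simp: bij_betw_def intro: inj_on_subset)
  have "f ` {..<x} = {..<f x}"
  proof (intro equalityI subsetI)
    fix z assume "z \<in> f ` {..<x}"
    then obtain y where y: "z = f y" "y < x" by auto
    then have "\<not> f x \<le> f y"
      using mono[of x y] \<open>x < n\<close> by simp
    with y show "z \<in> {..<f x}" by simp
  next
    fix z assume "z \<in> {..<f x}"
    then have z: "z < f x" by simp
    moreover have "f x < n" using f \<open>x < n\<close> .
    ultimately obtain y where y: "y < n" "z = f y"
      using bij unfolding bij_betw_def by (metis image_iff lessThan_iff less_trans)
    then have "\<not> x \<le> y"
      using mono[of x y] \<open>x < n\<close> z by simp
    with y show "z \<in> f ` {..<x}" by auto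
  qed
  then have "card (f ` {..<x}) = f x" by simp
  with inj show ?thesis by (simp add: card_image)
qed

lemma isomorphic_std_imp_eq:
  assumes "ordered_binary_structure k (std n \<rho>)" "ordered_binary_structure k (std n' \<rho>')"
    and "isomorphic (std n \<rho>) (std n' \<rho>')"
  shows "n = n' \<and> \<rho> = \<rho>'"
proof -
  obtain f where f: "bij_betw f {..<n} {..<n'}"
    and le: "\<forall>x<n. \<forall>y<n. x \<le> y \<longleftrightarrow> f x \<le> f y \<and> f y < n'"
    and re: "\<forall>i<length \<rho>. \<forall>x<n. \<forall>y<n. (x, y) \<in> \<rho> ! i \<longleftrightarrow> (f x, f y) \<in> \<rho>' ! i"
    using assms(3) unfolding isomorphic_def by auto
  have "n = n'" using bij_betw_same_card[OF f] by simp
  have id: "f x = x" if "x < n" for x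
  proof (rule strict_mono_on_lessThan_id[OF _ _ that])
    show "bij_betw f {..<n} {..<n}" using f \<open>n = n'\<close> by simp
    show "f x \<le> f y \<longleftrightarrow> x \<le> y" if "x < n" "y < n" for x y
      using le bij_betwE[OF f] that by auto
  qed
  have len: "length \<rho> = k" "length \<rho>' = k"
    and sub: "\<And>i. i < k \<Longrightarrow> \<rho> ! i \<subseteq> {..<n} \<times> {..<n}" "\<And>i. i < k \<Longrightarrow> \<rho>' ! i \<subseteq> {..<n} \<times> {..<n}"
    using assms(1,2) \<open>n = n'\<close> by (auto simp: ordered_binary_structure_std_iff)
  have "\<rho> ! i = \<rho>' ! i" if "i < k" for i
  proof (rule set_eqI, clarify)
    fix x y
    show "(x, y) \<in> \<rho> ! i \<longleftrightarrow> (x, y) \<in> \<rho>' ! i"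
    proof (cases "x < n \<and> y < n")
      case True then show ?thesis using re id that len by auto
    next
      case False then show ?thesis using sub that by blast
    qed
  qed
  then have "\<rho> = \<rho>'" using len by (simp add: list_eq_iff_nth_eq)
  with \<open>n = n'\<close> show ?thesis ..
qed

lemma finite_ordered_binary_structure_std:
  "finite {\<rho>. ordered_binary_structure k (std n \<rho>)}"
proof (rule finite_subset)
  show "{\<rho>. ordered_binary_structure k (std n \<rho>)} \<subseteq>
      {\<rho>. set \<rho> \<subseteq> Pow ({..<n} \<times> {..<n}) \<and> length \<rho> = k}"
    by (auto simp: ordered_binary_structure_std_iff)
  show "finite {\<rho>. set \<rho> \<subseteq> Pow ({..<n} \<times> {..<n}) \<and> length \<rho> = k}"
    by (rule finite_lists_length_eq) simp
qed

context
  fixes k C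
  assumes C: "hereditary_class k C"
begin

lemma hereditary_classD:
  assumes "R \<in> C"
  shows "ordered_binary_structure k R" "finite (elts R)"
  using C assms unfolding hereditary_class_def by blast+

lemma hereditary_class_isomorphic:
  "R \<in> C \<Longrightarrow> ordered_binary_structure k S \<Longrightarrow> isomorphic R S \<Longrightarrow> S \<in> C"
  using C unfolding hereditary_class_def by blast

lemma hereditary_class_restriction:
  "R \<in> C \<Longrightarrow> A \<subseteq> elts R \<Longrightarrow> restriction R A \<in> C"
  using C unfolding hereditary_class_def by blast

lemma hereditary_class_std_exists:
  assumes "R \<in> C"
  obtains \<rho> where "isomorphic (std (card (elts R)) \<rho>) R" "std (card (elts R)) \<rho> \<in> C"
  using isomorphic_std_exists[OF hereditary_classD[OF assms]]
    hereditary_class_isomorphic[OF assms] isomorphic_sym by metis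

lemma finite_hereditary_class_std: "finite {\<rho>. std n \<rho> \<in> C}"
  by (rule finite_subset[OF _ finite_ordered_binary_structure_std[of k n]])
    (auto dest: hereditary_classD)

text \<open>By rigidity two different structures \<open>std n \<rho>\<close> in the class are never
  isomorphic, so they form a system of representatives.\<close>

lemma profile_eq_card_std: "profile C n = card {\<rho>. std n \<rho> \<in> C}"
proof -
  define M where "M = {R \<in> C. finite (elts R) \<and> card (elts R) = n}"
  define E where "E = {(R, S). R \<in> M \<and> S \<in> M \<and> isomorphic R S}"
  have "bij_betw (\<lambda>\<rho>. E `` {std n \<rho>}) {\<rho>. std n \<rho> \<in> C} (M // E)"
  proof (rule bij_betwI')
    fix \<rho> \<rho>' assume mem: "\<rho> \<in> {\<rho>. std n \<rho> \<in> C}" "\<rho>' \<in> {\<rho>. std n \<rho> \<in> C}"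
    show "E `` {std n \<rho>} = E `` {std n \<rho>'} \<longleftrightarrow> \<rho> = \<rho>'"
    proof
      assume "E `` {std n \<rho>} = E `` {std n \<rho>'}"
      moreover have "std n \<rho>' \<in> E `` {std n \<rho>'}"
        using mem by (auto simp: E_def M_def)
      ultimately have "isomorphic (std n \<rho>) (std n \<rho>')"
        by (auto simp: E_def)
      with mem show "\<rho> = \<rho>'"
        using isomorphic_std_imp_eq hereditary_classD(1) by blast
    qed simp
  next
    fix \<rho> assume "\<rho> \<in> {\<rho>. std n \<rho> \<in> C}"
    then show "E `` {std n \<rho>} \<in> M // E"
      by (intro quotientI) (auto simp: M_def)
  next
    fix X assume "X \<in> M // E"
    then obtain R where R: "R \<in> M" "X = E `` {R}" by (rule quotientE)
    then obtain \<rho> where \<rho>: "isomorphic (std n \<rho>) R" "std n \<rho> \<in> C"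
      using hereditary_class_std_exists[of R] by (auto simp: M_def)
    have "E `` {R} = E `` {std n \<rho>}"
      using R \<rho> isomorphic_trans[OF \<rho>(1)] isomorphic_trans[OF isomorphic_sym[OF \<rho>(1)]]
      by (auto simp: E_def M_def)
    with R \<rho> show "\<exists>\<rho>\<in>{\<rho>. std n \<rho> \<in> C}. X = E `` {std n \<rho>}" by auto
  qed
  then show ?thesis
    unfolding profile_def Let_def M_def[symmetric] E_def[symmetric]
    by (simp add: bij_betw_same_card)
qed

end

section \<open>Induced substructures, renumbered to an initial segment\<close>

definition pull :: "(nat \<Rightarrow> nat) \<Rightarrow> nat rel list \<Rightarrow> nat \<Rightarrow> nat rel list" where
  "pull e \<rho> n = map (\<lambda>r. {(x, y). x < n \<and> y < n \<and> (e x, e y) \<in> r}) \<rho>"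

lemma isomorphic_pull:
  assumes "strict_mono_on {..<m} e" "e ` {..<m} \<subseteq> {..<n}"
  shows "isomorphic (std m (pull e \<rho> m)) (restriction (std n \<rho>) (e ` {..<m}))"
proof (rule isomorphic_stdI[where h = e])
  have "inj_on e {..<m}" using assms(1) by (rule strict_mono_on_imp_inj_on)
  then show "bij_betw e {..<m} (elts (restriction (std n \<rho>) (e ` {..<m})))"
    using assms(2) by (auto simp: bij_betw_def)
  show "(e x, e y) \<in> leq (restriction (std n \<rho>) (e ` {..<m})) \<longleftrightarrow> x \<le> y"
    if "x < m" "y < m" for x y
    using assms that by (auto simp: strict_mono_on_less_eq)
qed (auto simp: pull_def)

lemma pull_in_hereditary_class:
  assumes C: "hereditary_class k C" and mem: "std n \<rho> \<in> C"
    and e: "strict_mono_on {..<m} e" "e ` {..<m} \<subseteq> {..<n}"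
  shows "std m (pull e \<rho> m) \<in> C"
proof -
  have "ordered_binary_structure k (std m (pull e \<rho> m))"
    using hereditary_classD(1)[OF C mem]
    by (auto simp: ordered_binary_structure_std_iff pull_def)
  moreover have "restriction (std n \<rho>) (e ` {..<m}) \<in> C"
    using hereditary_class_restriction[OF C mem] e by simp
  ultimately show ?thesis
    using hereditary_class_isomorphic[OF C] isomorphic_sym[OF isomorphic_pull[OF e]] by blast
qed

section \<open>Bad positions and exponential growth\<close>

text \<open>The relations between \<open>x\<close> and \<open>Suc x\<close> themselves are not
  compared: the order already distinguishes these two points, and inside a block a relation may
  depend on the order.\<close>

definition bad :: "nat \<Rightarrow> nat rel list \<Rightarrow> nat set" where
  "bad n \<rho> = {x. Suc x < n \<and> (\<exists>r \<in> set \<rho>. ((x, x) \<in> r) \<noteq> ((Suc x, Suc x) \<in> r) \<or>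
     (\<exists>z < n. z \<noteq> x \<and> z \<noteq> Suc x \<and>
        (((x, z) \<in> r) \<noteq> ((Suc x, z) \<in> r) \<or> ((z, x) \<in> r) \<noteq> ((z, Suc x) \<in> r))))}"

lemma bad_subset: "bad n \<rho> \<subseteq> {..<n - 1}"
  by (auto simp: bad_def)

lemma finite_bad [simp]: "finite (bad n \<rho>)"
  using bad_subset finite_subset by blast

text \<open>Double counting of the arcs from \<open>y\<close> to the points of \<open>g y\<close>:
  the average in-degree on \<open>V\<close> is at most the largest out-degree.\<close>

lemma exists_small_indegree:
  assumes "finite V" "V \<noteq> {}" and g: "\<And>x. x \<in> V \<Longrightarrow> finite (g x) \<and> card (g x) \<le> d"
  shows "\<exists>x\<in>V. card {y \<in> V. x \<in> g y} \<le> d"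
proof (rule ccontr)
  assume "\<not> ?thesis"
  then have "(\<Sum>x\<in>V. d) < (\<Sum>x\<in>V. card {y \<in> V. x \<in> g y})"
    using assms by (intro sum_strict_mono) auto
  also have "\<dots> = (\<Sum>x\<in>V. \<Sum>y\<in>V. if x \<in> g y then 1 else 0)"
    using assms(1) by (simp add: sum.If_cases Int_def)
  also have "\<dots> = (\<Sum>y\<in>V. \<Sum>x\<in>V. if x \<in> g y then 1 else 0)"
    by (rule sum.swap)
  also have "\<dots> = (\<Sum>y\<in>V. card {x \<in> V. x \<in> g y})"
    using assms(1) by (simp add: sum.If_cases Int_def)
  also have "\<dots> \<le> (\<Sum>y\<in>V. d)"
  proof (rule sum_mono)
    fix y assume "y \<in> V"
    then show "card {x \<in> V. x \<in> g y} \<le> d"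
      using g[of y] card_mono[of "g y" "{x \<in> V. x \<in> g y}"] by fastforce
  qed
  finally show False by simp
qed

text \<open>Greedy choice. A point of in-degree at most \<open>d\<close> is kept, and it, its
  in-neighbours and its out-neighbours are discarded; each round costs at most
  \<open>2 * d + 1\<close> points.\<close>

lemma independent_subset_exists:
  assumes "finite V" and g: "\<And>x. x \<in> V \<Longrightarrow> finite (g x) \<and> card (g x) \<le> d"
    and "(2 * d + 1) * m \<le> card V"
  shows "\<exists>J\<subseteq>V. card J = m \<and> (\<forall>x\<in>J. \<forall>y\<in>J. x \<noteq> y \<longrightarrow> x \<notin> g y)"
  using assms
proof (induction m arbitrary: V)
  case 0
  then show ?case by (intro exI[of _ "{}"]) auto
next
  case (Suc m)
  from Suc.prems have "V \<noteq> {}" by auto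
  then obtain x where x: "x \<in> V" "card {y \<in> V. x \<in> g y} \<le> d"
    using exists_small_indegree[of V g d] Suc.prems by blast
  define N where "N = insert x ({y \<in> V. x \<in> g y} \<union> g x)"
  have "card N \<le> Suc (card {y \<in> V. x \<in> g y} + card (g x))"
    unfolding N_def by (rule order_trans[OF card_insert_le_m1 _])
      (auto intro: card_Un_le)
  also have "\<dots> \<le> 2 * d + 1"
    using x Suc.prems(2)[of x] by simp
  finally have N: "card N \<le> 2 * d + 1" .
  have "finite N"
    using Suc.prems(1,2) x by (simp add: N_def)
  then have "card V \<le> card (V - N) + card N"
    using Suc.prems(1) by (metis card_Un_le card_mono finite_Diff finite_Un Un_Diff_cancel2 order_trans sup_ge1)
  then have "(2 * d + 1) * m \<le> card (V - N)"
    using N Suc.prems(3) by (simp add: algebra_simps)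
  then obtain J where J: "J \<subseteq> V - N" "card J = m"
    "\<forall>x\<in>J. \<forall>y\<in>J. x \<noteq> y \<longrightarrow> x \<notin> g y"
    using Suc.IH[of "V - N"] Suc.prems by auto
  have "finite J" using J Suc.prems(1) finite_subset by blast
  moreover have "x \<notin> J" using J by (auto simp: N_def)
  ultimately have "card (insert x J) = Suc m" using J by simp
  moreover have "y \<notin> g x \<and> x \<notin> g y" if "y \<in> J" for y
    using J that by (auto simp: N_def)
  ultimately show ?case
    using J x by (intro exI[of _ "insert x J"]) auto
qed

text \<open>Since finite ordered structures are rigid, these lists stand for the isomorphism types
  of the restrictions with \<open>m\<close> elements.\<close>

definition subs :: "nat \<Rightarrow> nat rel list \<Rightarrow> nat \<Rightarrow> nat rel list set" where
  "subs n \<rho> m = {pull e \<rho> m | e. strict_mono_on {..<m} e \<and> e ` {..<m} \<subseteq> {..<n}}"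

lemma subs_in_hereditary_class:
  assumes "hereditary_class k C" "std n \<rho> \<in> C"
  shows "subs n \<rho> m \<subseteq> {\<rho>. std m \<rho> \<in> C}"
  using pull_in_hereditary_class[OF assms] by (auto simp: subs_def)

lemma card_subs_le_profile:
  assumes "hereditary_class k C" "std n \<rho> \<in> C"
  shows "card (subs n \<rho> m) \<le> profile C m"
  using card_mono[OF finite_hereditary_class_std[OF assms(1)] subs_in_hereditary_class[OF assms]]
  by (simp add: profile_eq_card_std[OF assms(1)])

text \<open>Choosing \<open>x\<close> or \<open>Suc x\<close> independently for each \<open>x \<in> J\<close> does not alter the order pattern, since
  nothing lies in between; the witnesses then tell the \<open>2 ^ card J\<close> choices apart.\<close>

lemma card_subs_ge:
  assumes J: "J \<subseteq> bad n \<rho>" and Z: "Z \<subseteq> {..<n}"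
    and disj: "J \<inter> Suc ` J = {}" "Z \<inter> J = {}" "Z \<inter> Suc ` J = {}"
    and W: "\<And>x. x \<in> J \<Longrightarrow> \<exists>r\<in>set \<rho>. ((x, x) \<in> r) \<noteq> ((Suc x, Suc x) \<in> r) \<or>
     (\<exists>z \<in> Z. (((x, z) \<in> r) \<noteq> ((Suc x, z) \<in> r) \<or> ((z, x) \<in> r) \<noteq> ((z, Suc x) \<in> r)))"
    and m: "card (J \<union> Z) = m"
    and fin: "finite (subs n \<rho> m)"
  shows "2 ^ card J \<le> card (subs n \<rho> m)"
proof -
  have finJ: "finite J" using J finite_subset finite_bad by blast
  have finZ: "finite Z" using Z finite_subset by blast
  have Jn: "Suc x < n" if "x \<in> J" for x
    using J that by (auto simp: bad_def)
  define h where "h = (!) (sorted_list_of_set (J \<union> Z))"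
  have h: "strict_mono_on {..<m} h" "h ` {..<m} = J \<union> Z"
  proof -
    have fin: "finite (J \<union> Z)" using finJ finZ by simp
    have len: "length (sorted_list_of_set (J \<union> Z)) = m"
      using fin m by simp
    show "strict_mono_on {..<m} h"
      unfolding h_def strict_mono_on_def
      using strict_sorted_list_of_set[of "J \<union> Z"] len
      by (auto simp: sorted_wrt_iff_nth_less)
    show "h ` {..<m} = J \<union> Z"
      unfolding h_def using len fin
      by (metis nth_image set_sorted_list_of_set take_all_iff order_refl lessThan_atLeast0)
  qed
  define e where "e X p = (if h p \<in> X then Suc (h p) else h p)" for X p
  have mono: "strict_mono_on {..<m} (e X)" if "X \<subseteq> J" for X
  proof (rule strict_mono_onI)
    fix p q assume pq: "p \<in> {..<m}" "q \<in> {..<m}" "p < q"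
    then have less: "h p < h q" using h(1) by (simp add: strict_mono_on_def)
    have "h q \<in> J \<union> Z" using h(2) pq by blast
    then have "h q \<noteq> Suc (h p)" if "h p \<in> X"
      using that \<open>X \<subseteq> J\<close> disj by blast
    with less show "e X p < e X q" by (auto simp: e_def)
  qed
  have range: "e X ` {..<m} \<subseteq> {..<n}" if "X \<subseteq> J" for X
  proof clarify
    fix p assume "p < m"
    then have "h p \<in> J \<union> Z" using h(2) by blast
    then show "e X p < n"
      using Jn Z that by (fastforce simp: e_def)
  qed
  have sub: "pull (e X) \<rho> m \<in> subs n \<rho> m" if "X \<in> Pow J" for X
    using mono[of X] range[of X] that unfolding subs_def by blast
  have neq: "pull (e X) \<rho> m \<noteq> pull (e Y) \<rho> m"
    if XY: "X \<subseteq> J" "Y \<subseteq> J" "x \<in> X" "x \<notin> Y" for X Y x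
  proof
    assume eq: "pull (e X) \<rho> m = pull (e Y) \<rho> m"
    have pull: "(e X p, e X q) \<in> r \<longleftrightarrow> (e Y p, e Y q) \<in> r"
      if r: "r \<in> set \<rho>" and "p < m" "q < m" for p q r
    proof -
      have "{(p, q). p < m \<and> q < m \<and> (e X p, e X q) \<in> r} =
            {(p, q). p < m \<and> q < m \<and> (e Y p, e Y q) \<in> r}"
        using eq r unfolding pull_def map_eq_conv by (rule bspec)
      from eqset_imp_iff[OF this, of "(p, q)"] that show ?thesis by simp
    qed
    have "x \<in> J" using XY by auto
    then have "x \<in> h ` {..<m}" using h(2) by simp
    then obtain p where p: "p < m" "h p = x" by auto
    have ep: "e X p = Suc x" "e Y p = x" using p XY by (auto simp: e_def)
    obtain r where r: "r \<in> set \<rho>" and wit: "((x, x) \<in> r) \<noteq> ((Suc x, Suc x) \<in> r) \<or>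
       (\<exists>z \<in> Z. (((x, z) \<in> r) \<noteq> ((Suc x, z) \<in> r) \<or> ((z, x) \<in> r) \<noteq> ((z, Suc x) \<in> r)))"
      using W[OF \<open>x \<in> J\<close>] by blast
    have "((x, x) \<in> r) = ((Suc x, Suc x) \<in> r)"
      using pull[OF r p(1) p(1)] ep by simp
    then obtain z where z: "z \<in> Z" and
      zwit: "((x, z) \<in> r) \<noteq> ((Suc x, z) \<in> r) \<or> ((z, x) \<in> r) \<noteq> ((z, Suc x) \<in> r)"
      using wit by blast
    \<comment> \<open>Points of \<open>Z\<close> are never moved, so \<open>z\<close> has the same
      index \<open>q\<close> under both choices and the two lists differ at \<open>p\<close> and
      \<open>q\<close>.\<close>
    have "z \<in> h ` {..<m}" using h(2) z by simp
    then obtain q where q: "q < m" "h q = z" by auto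
    have "z \<notin> J" using z disj by blast
    then have eq: "e X q = z" "e Y q = z" using q XY by (auto simp: e_def)
    show False
      using pull[OF r p(1) q(1)] pull[OF r q(1) p(1)] ep eq zwit by simp
  qed
  have "inj_on (\<lambda>X. pull (e X) \<rho> m) (Pow J)"
  proof (rule inj_onI)
    fix X Y assume "X \<in> Pow J" "Y \<in> Pow J" "pull (e X) \<rho> m = pull (e Y) \<rho> m"
    then show "X = Y"
      using neq[of X Y] neq[of Y X] by auto
  qed
  then have "card (Pow J) \<le> card (subs n \<rho> m)"
    using sub fin by (intro card_inj_on_le) auto
  then show ?thesis using finJ by (simp add: card_Pow)
qed

text \<open>Half of the \<open>m\<close> points come from bad pairs that can be chosen freely; the
  other half holds the witnesses, at most one per pair, padded so that all choices have exactly
  \<open>m\<close> points. The factor 9 is generous: \<open>7 * (m div 2)\<close> bad positions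
  suffice for independence, and the rest guarantees room for the padding.\<close>

lemma exp_many_subs:
  assumes "9 * m \<le> card (bad n \<rho>)"
    and fin: "finite (subs n \<rho> m)"
  shows "2 ^ (m div 2) \<le> card (subs n \<rho> m)"
proof -
  \<comment> \<open>A loop needs no witness, so the witness is encoded as a set with at most one
    point.\<close>
  have "\<exists>W. card W \<le> 1 \<and> W \<subseteq> {..<n} - {x, Suc x} \<and>
     (\<exists>r\<in>set \<rho>. ((x, x) \<in> r) \<noteq> ((Suc x, Suc x) \<in> r) \<or>
     (\<exists>z \<in> W. (((x, z) \<in> r) \<noteq> ((Suc x, z) \<in> r) \<or> ((z, x) \<in> r) \<noteq> ((z, Suc x) \<in> r))))"
    (is "\<exists>W. ?P x W") if x: "x \<in> bad n \<rho>" for x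
  proof -
    obtain r where r: "r \<in> set \<rho>" "((x, x) \<in> r) \<noteq> ((Suc x, Suc x) \<in> r) \<or>
      (\<exists>z < n. z \<noteq> x \<and> z \<noteq> Suc x \<and>
        (((x, z) \<in> r) \<noteq> ((Suc x, z) \<in> r) \<or> ((z, x) \<in> r) \<noteq> ((z, Suc x) \<in> r)))"
      using x by (auto simp: bad_def)
    then consider "((x, x) \<in> r) \<noteq> ((Suc x, Suc x) \<in> r)" | z where "z < n" "z \<noteq> x" "z \<noteq> Suc x"
      "((x, z) \<in> r) \<noteq> ((Suc x, z) \<in> r) \<or> ((z, x) \<in> r) \<noteq> ((z, Suc x) \<in> r)"
      by blast
    then show ?thesis
    proof cases
      case 1
      with r show ?thesis by (intro exI[of _ "{}"]) auto
    next
      case (2 z)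
      with r show ?thesis by (intro exI[of _ "{z}"]) auto
    qed
  qed
  then obtain W where W: "\<And>x. x \<in> bad n \<rho> \<Longrightarrow> ?P x (W x)" by metis
  have finW: "finite (W x)" if "x \<in> bad n \<rho>" for x
    using W[OF that] finite_subset by blast
  \<comment> \<open>A point \<open>x\<close> is in \<open>g y\<close> exactly when it is
    \<open>Suc y\<close> or when the witness of \<open>y\<close> is \<open>x\<close> or
    \<open>Suc x\<close>. Truncation at \<open>0 - 1\<close> adds nothing, as \<open>0\<close> is
    then in \<open>W y\<close> itself. At most three points arise, hence
    \<open>d = 3\<close>.\<close>
  define g where "g x = insert (Suc x) (W x \<union> (\<lambda>z. z - 1) ` W x)" for x
  have g3: "finite (g x) \<and> card (g x) \<le> 3" if x: "x \<in> bad n \<rho>" for x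
  proof
    show "finite (g x)" using finW[OF x] by (simp add: g_def)
    have "card ((\<lambda>z. z - 1) ` W x) \<le> 1"
      using card_image_le[OF finW[OF x], of "\<lambda>z. z - 1"] W[OF x] by simp
    then have "card (W x \<union> (\<lambda>z. z - 1) ` W x) \<le> 2"
      using card_Un_le[of "W x" "(\<lambda>z. z - 1) ` W x"] W[OF x] by linarith
    then show "card (g x) \<le> 3"
      unfolding g_def by (intro order_trans[OF card_insert_le_m1[of 3]]) auto
  qed
  obtain J where J: "J \<subseteq> bad n \<rho>" "card J = m div 2"
    and ind: "\<And>x y. x \<in> J \<Longrightarrow> y \<in> J \<Longrightarrow> x \<noteq> y \<Longrightarrow> x \<notin> g y"
  proof -
    have "(2 * 3 + 1) * (m div 2) \<le> card (bad n \<rho>)"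
      by (rule order_trans[OF _ assms(1)]) simp
    then show thesis
      using independent_subset_exists[OF finite_bad, of n \<rho> g 3 "m div 2"] that g3 by metis
  qed
  have finJ: "finite J" using J finite_subset finite_bad by blast
  define Z where "Z = (\<Union>x\<in>J. W x)"
  have "card Z \<le> (\<Sum>x\<in>J. card (W x))"
    unfolding Z_def by (rule card_UN_le[OF finJ])
  also have "\<dots> \<le> (\<Sum>x\<in>J. 1)"
    using W J by (intro sum_mono) auto
  finally have cardZ: "card Z \<le> m div 2" using J by simp
  \<comment> \<open>Everything outside the chosen pairs; the padding is taken from here so that it
    moves with no choice.\<close>
  define U where "U = {..<n} - (J \<union> Suc ` J)"
  have "Z \<subseteq> U"
  proof
    fix z assume "z \<in> Z"
    then obtain x where x: "x \<in> J" "z \<in> W x" by (auto simp: Z_def)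
    then have z: "z < n" "z \<noteq> x" "z \<noteq> Suc x" using W J by blast+
    have "z \<noteq> y \<and> z \<noteq> Suc y" if "y \<in> J" "y \<noteq> x" for y
      using ind[of y x] that x by (force simp: g_def)
    with z show "z \<in> U" by (auto simp: U_def)
  qed
  moreover have "m - m div 2 \<le> card U"
  proof -
    have "card (bad n \<rho>) \<le> n - 1"
      using card_mono[OF _ bad_subset[of n \<rho>]] by simp
    then have "9 * m \<le> n" using assms(1) by simp
    moreover have "card (J \<union> Suc ` J) \<le> 2 * (m div 2)"
      using card_Un_le[of J "Suc ` J"] J finJ by (simp add: card_image)
    then have "n \<le> card U + 2 * (m div 2)"
      unfolding U_def using diff_card_le_card_Diff[of "J \<union> Suc ` J" "{..<n}"] finJ by simp
    ultimately show ?thesis by simp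
  qed
  moreover have "finite U" by (simp add: U_def)
  moreover have "card Z \<le> m - m div 2" using cardZ by linarith
  ultimately obtain Z' where Z': "Z \<subseteq> Z'" "Z' \<subseteq> U" "card Z' = m - m div 2"
    using exists_subset_between[of Z "m - m div 2" U] by blast
  have disj: "Z' \<inter> J = {}" "Z' \<inter> Suc ` J = {}" "Z' \<subseteq> {..<n}"
    using Z' by (auto simp: U_def)
  have "finite Z'" using disj finite_subset by blast
  have "2 ^ card J \<le> card (subs n \<rho> m)"
  proof (rule card_subs_ge[OF J(1) disj(3) _ disj(1,2) _ _ fin])
    show "J \<inter> Suc ` J = {}"
      using ind[of "Suc _"] by (force simp: g_def)
    show "card (J \<union> Z') = m"
      using disj finJ \<open>finite Z'\<close> J Z' by (simp add: card_Un_disjoint Int_commute)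
    show "\<exists>r\<in>set \<rho>. ((x, x) \<in> r) \<noteq> ((Suc x, Suc x) \<in> r) \<or>
       (\<exists>z \<in> Z'. (((x, z) \<in> r) \<noteq> ((Suc x, z) \<in> r) \<or> ((z, x) \<in> r) \<noteq> ((z, Suc x) \<in> r)))"
      if "x \<in> J" for x
    proof -
      have "W x \<subseteq> Z'" using that Z' by (auto simp: Z_def)
      then show ?thesis using W[of x] that J by blast
    qed
  qed
  then show ?thesis by (simp add: J)
qed

text \<open>The number of points of each colour determines a restriction up to isomorphism, hence by
  rigidity determines its list; there are at most \<open>(m + 1) ^ l\<close> vectors of such
  numbers.\<close>

lemma card_subs_le:
  assumes "has_monomorphic_decomposition_le (std n \<rho>) l" "ordered_binary_structure k (std n \<rho>)"
  shows "finite (subs n \<rho> m) \<and> card (subs n \<rho> m) \<le> (m + 1) ^ l"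
proof -
  obtain f where f: "f ` {..<n} \<subseteq> {..<l}" and mono: "monomorphic_coloring (std n \<rho>) f"
    using assms unfolding has_monomorphic_decomposition_le_iff by auto
  define E where "E = {e :: nat \<Rightarrow> nat. strict_mono_on {..<m} e \<and> e ` {..<m} \<subseteq> {..<n}}"
  define v where "v e = (\<lambda>i\<in>{..<l}. card {a \<in> e ` {..<m}. f a = i})" for e
  have v_in: "v ` E \<subseteq> {..<l} \<rightarrow>\<^sub>E {..m}"
  proof clarify
    fix e
    have "card {a \<in> e ` {..<m}. f a = i} \<le> m" for i
    proof -
      have "card {a \<in> e ` {..<m}. f a = i} \<le> card (e ` {..<m})"
        by (intro card_mono) auto
      also have "\<dots> \<le> m" using card_image_le[of "{..<m}" e] by simp
      finally show ?thesis .
    qed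
    then show "v e \<in> {..<l} \<rightarrow>\<^sub>E {..m}" by (auto simp: v_def)
  qed
  have eq: "pull e \<rho> m = pull e' \<rho> m" if E: "e \<in> E" "e' \<in> E" and v: "v e = v e'" for e e'
  proof -
    have "card {a \<in> e ` {..<m}. f a = i} = card {a \<in> e' ` {..<m}. f a = i}" for i
    proof (cases "i < l")
      case True
      then show ?thesis using fun_cong[OF v, of i] by (simp add: v_def)
    next
      case False
      then have "f a \<noteq> i" if "a < n" for a
        using f that by auto
      then have "{a \<in> e ` {..<m}. f a = i} = {}" "{a \<in> e' ` {..<m}. f a = i} = {}"
        using E by (auto simp: E_def)
      then show ?thesis by (simp only:)
    qed
    then have "isomorphic (restriction (std n \<rho>) (e ` {..<m})) (restriction (std n \<rho>) (e' ` {..<m}))"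
      using mono E unfolding monomorphic_coloring_def E_def by simp
    moreover have "isomorphic (std m (pull e \<rho> m)) (restriction (std n \<rho>) (e ` {..<m}))"
      "isomorphic (std m (pull e' \<rho> m)) (restriction (std n \<rho>) (e' ` {..<m}))"
      using E isomorphic_pull by (auto simp: E_def)
    ultimately have "isomorphic (std m (pull e \<rho> m)) (std m (pull e' \<rho> m))"
      by (blast intro: isomorphic_trans isomorphic_sym)
    moreover have "ordered_binary_structure k (std m (pull e \<rho> m))" for e
      using assms(2) by (auto simp: ordered_binary_structure_std_iff pull_def)
    ultimately show ?thesis using isomorphic_std_imp_eq by blast
  qed
  \<comment> \<open>Recovers a list from its colour vector, through an arbitrary embedding with that
    vector.\<close>
  define w where "w x = pull (SOME e. e \<in> E \<and> v e = x) \<rho> m" for x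
  have "subs n \<rho> m \<subseteq> w ` v ` E"
  proof
    fix \<sigma> assume "\<sigma> \<in> subs n \<rho> m"
    then obtain e where e: "e \<in> E" "\<sigma> = pull e \<rho> m" by (auto simp: subs_def E_def)
    have "(SOME e'. e' \<in> E \<and> v e' = v e) \<in> E \<and> v (SOME e'. e' \<in> E \<and> v e' = v e) = v e"
      by (rule someI[of _ e]) (use e in auto)
    then have "pull e \<rho> m = w (v e)" unfolding w_def using e by (intro eq) simp_all
    with e show "\<sigma> \<in> w ` v ` E" by simp
  qed
  also have "\<dots> \<subseteq> w ` ({..<l} \<rightarrow>\<^sub>E {..m})" using v_in by blast
  finally have sub: "subs n \<rho> m \<subseteq> w ` ({..<l} \<rightarrow>\<^sub>E {..m})" .
  have fin: "finite ({..<l} \<rightarrow>\<^sub>E {..m})" by (intro finite_PiE) auto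
  have "card (subs n \<rho> m) \<le> card ({..<l} \<rightarrow>\<^sub>E {..m})"
    using card_mono[OF finite_imageI[OF fin] sub] card_image_le[OF fin, of w] by linarith
  then show ?thesis
    using finite_subset[OF sub finite_imageI[OF fin]] by (simp add: card_PiE)
qed

lemma bad_unbounded_imp_exponential:
  assumes C: "hereditary_class k C" and unb: "\<And>L. \<exists>n \<rho>. std n \<rho> \<in> C \<and> L \<le> card (bad n \<rho>)"
  shows "at_least_exponential (profile C)"
proof -
  have "2 ^ (m div 2) \<le> profile C m" for m
  proof -
    obtain n \<rho> where mem: "std n \<rho> \<in> C" and card: "9 * m \<le> card (bad n \<rho>)"
      using unb by blast
    have "finite (subs n \<rho> m)"
      using finite_subset[OF subs_in_hereditary_class[OF C mem] finite_hereditary_class_std[OF C]] .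
    then show ?thesis
      using exp_many_subs[OF card] card_subs_le_profile[OF C mem, of m] by simp
  qed
  \<comment> \<open>Since \<open>m \<le> 2 * (m div 2) + 1\<close>, rounding down loses a factor of
    at most \<open>sqrt 2\<close>, which is estimated by 2; this gives \<open>a = 1/2\<close> and
    \<open>c = sqrt 2\<close>.\<close>
  then have bound: "(1 / 2) * sqrt 2 ^ m \<le> real (profile C m)" for m
  proof -
    have "sqrt 2 ^ m \<le> sqrt 2 ^ (2 * (m div 2) + 1)"
      by (rule power_increasing) auto
    also have "\<dots> = 2 ^ (m div 2) * sqrt 2"
      by (simp add: power_mult)
    also have "\<dots> \<le> 2 ^ (m div 2) * 2"
      by (intro mult_left_mono) (auto intro: real_le_lsqrt)
    also have "\<dots> \<le> real (profile C m) * 2"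
      using \<open>2 ^ (m div 2) \<le> profile C m\<close>
      by (metis mult_right_mono numeral_power_le_of_nat_cancel_iff zero_le_numeral)
    finally show ?thesis by simp
  qed
  then show ?thesis
    unfolding at_least_exponential_def
    by (intro exI[of _ "1/2"] exI[of _ "sqrt 2"]) auto
qed

lemma power_less_two_power_half: "\<exists>m. (m + 1) ^ l < (2 :: nat) ^ (m div 2)"
proof
  \<comment> \<open>With \<open>m + 1 = 2 ^ s\<close> both sides are powers of two and only
    exponents are compared: \<open>s * l\<close> is quadratic in \<open>l\<close>, while
    \<open>m div 2 = 2 ^ (2 * l + 5) - 1\<close>. The offset 6 makes room for the factor 32 in
    \<open>32 * ((l + 1) * (l + 1))\<close>.\<close>
  define s where "s = 2 * l + 6"
  define m :: nat where "m = 2 ^ s - 1"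
  have "l + 1 \<le> 2 ^ l" by (simp add: Suc_leI)
  then have "(l + 1) * (l + 1) \<le> 2 ^ l * 2 ^ l" by (rule mult_le_mono) fact
  moreover have "2 ^ (2 * l + 5) = 32 * (2 ^ l * 2 ^ l :: nat)"
    by (simp only: power_add mult_2) simp
  ultimately have "32 * ((l + 1) * (l + 1)) \<le> 2 ^ (2 * l + 5)" by linarith
  moreover have "s * l + 1 < 32 * ((l + 1) * (l + 1))"
    by (simp add: s_def algebra_simps)
  moreover have "m div 2 = 2 ^ (2 * l + 5) - 1"
    by (simp add: m_def s_def power_add)
  ultimately have "s * l < m div 2" by linarith
  then have "(2 :: nat) ^ (s * l) < 2 ^ (m div 2)" by simp
  moreover have "m + 1 = 2 ^ s" by (simp add: m_def)
  ultimately show "(m + 1) ^ l < (2 :: nat) ^ (m div 2)" by (simp add: power_mult)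
qed

text \<open>A contradiction at one size suffices: for a single \<open>m\<close> with
  \<open>(m + 1) ^ l < 2 ^ (m div 2)\<close>, a member with \<open>9 * m\<close> bad positions would
  have too many restrictions of size \<open>m\<close>.\<close>

lemma bad_bounded_if_decomposition_bounded:
  assumes C: "hereditary_class k C" and dec: "\<forall>R \<in> C. has_monomorphic_decomposition_le R l"
  shows "\<exists>L. \<forall>n \<rho>. std n \<rho> \<in> C \<longrightarrow> card (bad n \<rho>) \<le> L"
proof -
  obtain m where m: "(m + 1) ^ l < 2 ^ (m div 2)"
    using power_less_two_power_half by blast
  have "card (bad n \<rho>) \<le> 9 * m" if mem: "std n \<rho> \<in> C" for n \<rho>
  proof (rule ccontr)
    assume "\<not> ?thesis"
    then have "9 * m \<le> card (bad n \<rho>)" by simp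
    moreover have "finite (subs n \<rho> m)" "card (subs n \<rho> m) \<le> (m + 1) ^ l"
      using card_subs_le[of n \<rho> l k m] dec mem hereditary_classD(1)[OF C mem] by auto
    ultimately show False using exp_many_subs[of m n \<rho>] m by simp
  qed
  then show ?thesis by blast
qed

section \<open>Inflations of templates\<close>

text \<open>The sublevel sets of a monotone function are initial segments, so membership is decided
  by their length.\<close>

lemma mono_le_iff_less_card:
  fixes b :: "nat \<Rightarrow> nat"
  assumes "\<And>x y. x \<le> y \<Longrightarrow> y < n \<Longrightarrow> b x \<le> b y" and "x < n"
  shows "b x \<le> i \<longleftrightarrow> x < card {y. y < n \<and> b y \<le> i}"
proof
  assume "b x \<le> i"
  then have "{..x} \<subseteq> {y. y < n \<and> b y \<le> i}"
    using assms by (auto intro: order_trans)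
  then have "card {..x} \<le> card {y. y < n \<and> b y \<le> i}"
    by (intro card_mono) auto
  then show "x < card {y. y < n \<and> b y \<le> i}" by simp
next
  assume *: "x < card {y. y < n \<and> b y \<le> i}"
  show "b x \<le> i"
  proof (rule ccontr)
    assume "\<not> b x \<le> i"
    then have "{y. y < n \<and> b y \<le> i} \<subseteq> {..<x}"
      using assms(1)[of x] by (auto simp: not_le intro!: leI)
        (meson leD le_trans linorder_le_less_linear)
    then have "card {y. y < n \<and> b y \<le> i} \<le> card {..<x}"
      by (intro card_mono) auto
    with * show False by simp
  qed
qed

lemma card_fibres_le_eq:
  fixes f :: "'a \<Rightarrow> nat" and g :: "'b \<Rightarrow> nat"
  assumes "finite A" "finite B" "\<And>i. card {a \<in> A. f a = i} = card {b \<in> B. g b = i}"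
  shows "card {a \<in> A. f a \<le> i} = card {b \<in> B. g b \<le> i}"
proof (induction i)
  case 0
  then show ?case using assms(3)[of 0] by simp
next
  case (Suc i)
  have split: "card {a \<in> X. h a \<le> Suc i} = card {a \<in> X. h a \<le> i} + card {a \<in> X. h a = Suc i}"
    if "finite X" for X :: "'c set" and h
  proof -
    have "{a \<in> X. h a \<le> Suc i} = {a \<in> X. h a \<le> i} \<union> {a \<in> X. h a = Suc i}" by auto
    moreover have "{a \<in> X. h a \<le> i} \<inter> {a \<in> X. h a = Suc i} = {}" by auto
    ultimately show ?thesis using that by (simp add: card_Un_disjoint)
  qed
  show ?case
    using assms Suc by (simp add: split)
qed

lemma card_eq_if_card_fibres_eq:
  fixes f :: "'a \<Rightarrow> nat" and g :: "'b \<Rightarrow> nat"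
  assumes "finite A" "finite B" "\<And>i. card {a \<in> A. f a = i} = card {b \<in> B. g b = i}"
  shows "card A = card B"
proof -
  define N where "N = Max (insert 0 (f ` A \<union> g ` B))"
  have "{a \<in> A. f a \<le> N} = A" "{b \<in> B. g b \<le> N} = B"
    unfolding N_def using assms(1,2) by auto
  then show ?thesis using card_fibres_le_eq[OF assms, of N] by simp
qed

text \<open>The fibre sizes give the sizes of all sublevel sets, and these initial segments
  determine a monotone function.\<close>

lemma mono_eq_if_card_fibres_eq:
  fixes b b' :: "nat \<Rightarrow> nat"
  assumes "\<And>x y. x \<le> y \<Longrightarrow> y < n \<Longrightarrow> b x \<le> b y" "\<And>x y. x \<le> y \<Longrightarrow> y < n \<Longrightarrow> b' x \<le> b' y"
    and "\<And>i. card {x. x < n \<and> b x = i} = card {x. x < n \<and> b' x = i}"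
    and "x < n"
  shows "b x = b' x"
proof -
  have "card {y. y < n \<and> b y \<le> i} = card {y. y < n \<and> b' y \<le> i}" for i
    using card_fibres_le_eq[of "{..<n}" "{..<n}" b b' i] assms(3) by simp
  then have "b x \<le> i \<longleftrightarrow> b' x \<le> i" for i
    using mono_le_iff_less_card[of n b x i] mono_le_iff_less_card[of n b' x i] assms by simp
  from this[of "b x"] this[of "b' x"] show ?thesis by simp
qed

text \<open>The natural numbers, read as pairs \<open>(i, t)\<close>, are arranged in blocks (first component) and
  ordered lexicographically. The key of a pair of points says in which blocks they lie and how
  they compare; a template \<open>q\<close> lists, for each relation, the keys at which it holds.\<close>

definition blk :: "nat \<Rightarrow> nat" where
  "blk a = fst (prod_decode a)"

definition pos :: "nat \<Rightarrow> nat" where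
  "pos a = snd (prod_decode a)"

definition lexle :: "nat \<Rightarrow> nat \<Rightarrow> bool" where
  "lexle a b \<longleftrightarrow> blk a < blk b \<or> blk a = blk b \<and> pos a \<le> pos b"

type_synonym key = "nat \<times> nat \<times> bool \<times> bool"

text \<open>Both comparisons are recorded, so that a key with both true marks equal points; loops
  are thereby kept apart from pairs inside one block.\<close>

definition key :: "nat \<Rightarrow> nat \<Rightarrow> key" where
  "key a b = (blk a, blk b, lexle a b, lexle b a)"

text \<open>Coding the pairs as natural numbers lets inflations be members of a class of type
  \<open>nat ordbin set\<close>. The set \<open>A\<close> may be infinite; the structures whose ages
  are used later are of this form.\<close>

definition inflate :: "key set list \<Rightarrow> nat set \<Rightarrow> nat ordbin" where
  "inflate q A = \<lparr>elts = A, leq = {(a, b). a \<in> A \<and> b \<in> A \<and> lexle a b},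
     rels = map (\<lambda>Q. {(a, b). a \<in> A \<and> b \<in> A \<and> key a b \<in> Q}) q\<rparr>"

lemma blk_prod_encode [simp]: "blk (prod_encode (i, t)) = i"
  and pos_prod_encode [simp]: "pos (prod_encode (i, t)) = t"
  by (simp_all add: blk_def pos_def)

lemma blk_pos_eqI: "blk a = blk b \<Longrightarrow> pos a = pos b \<Longrightarrow> a = b"
  unfolding blk_def pos_def by (metis prod.expand prod_decode_eq)

lemma lexle_linear_order: "linear_order_on A {(a, b). a \<in> A \<and> b \<in> A \<and> lexle a b}"
  unfolding order_on_defs refl_on_def trans_def antisym_def total_on_def lexle_def
  by (auto intro: blk_pos_eqI)

lemma inflate_simps [simp]:
  "elts (inflate q A) = A" "leq (inflate q A) = {(a, b). a \<in> A \<and> b \<in> A \<and> lexle a b}"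
  "rels (inflate q A) = map (\<lambda>Q. {(a, b). a \<in> A \<and> b \<in> A \<and> key a b \<in> Q}) q"
  by (simp_all add: inflate_def)

lemma restriction_inflate: "restriction (inflate q A) B = inflate q (A \<inter> B)"
  by (auto simp: inflate_def restriction_def)

lemma ordered_binary_structure_inflate:
  "length q = k \<Longrightarrow> ordered_binary_structure k (inflate q A)"
  using lexle_linear_order by (auto simp: ordered_binary_structure_def)

lemma isomorphic_inflate:
  assumes "bij_betw g A B" "\<And>a b. a \<in> A \<Longrightarrow> b \<in> A \<Longrightarrow> key (g a) (g b) = key a b"
  shows "isomorphic (inflate q A) (inflate q B)"
  unfolding isomorphic_def
proof (intro conjI exI[of _ g])
  have "g a \<in> B" if "a \<in> A" for a using assms(1) that by (auto simp: bij_betw_def)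
  then show "\<forall>i<length (rels (inflate q A)). \<forall>x\<in>elts (inflate q A). \<forall>y\<in>elts (inflate q A).
     ((x, y) \<in> rels (inflate q A) ! i) = ((g x, g y) \<in> rels (inflate q B) ! i)"
    "\<forall>x\<in>elts (inflate q A). \<forall>y\<in>elts (inflate q A).
       ((x, y) \<in> leq (inflate q A)) = ((g x, g y) \<in> leq (inflate q B))"
    using assms(2) by (auto simp: key_def)
qed (use assms in auto)

lemma inflate_enumeration:
  assumes "finite A"
  obtains h where "bij_betw h {..<card A} A"
    and "\<And>x y. x < card A \<Longrightarrow> y < card A \<Longrightarrow> key (h x) (h y) = (blk (h x), blk (h y), x \<le> y, y \<le> x)"
    and "\<And>x y. x \<le> y \<Longrightarrow> y < card A \<Longrightarrow> blk (h x) \<le> blk (h y)"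
proof (rule finite_linear_order_enumeration[OF lexle_linear_order assms])
  fix h
  assume h: "bij_betw h {..<card A} A"
    and le: "\<And>x y. x < card A \<Longrightarrow> y < card A \<Longrightarrow>
               (h x, h y) \<in> {(a, b). a \<in> A \<and> b \<in> A \<and> lexle a b} \<longleftrightarrow> x \<le> y"
  have "h x \<in> A" if "x < card A" for x using h that by (auto simp: bij_betw_def)
  then have le': "lexle (h x) (h y) \<longleftrightarrow> x \<le> y" if "x < card A" "y < card A" for x y
    using le[OF that] that by simp
  show thesis
  proof (rule that[OF h])
    show "key (h x) (h y) = (blk (h x), blk (h y), x \<le> y, y \<le> x)"
      if "x < card A" "y < card A" for x y
      using le' that by (simp add: key_def)
    show "blk (h x) \<le> blk (h y)" if "x \<le> y" "y < card A" for x y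
      using le'[of x y] that by (auto simp: lexle_def)
  qed
qed

lemma card_fibre_bij:
  assumes "bij_betw h {..<n} A"
  shows "card {x. x < n \<and> f (h x) = i} = card {a \<in> A. f a = i}"
proof -
  have "{a \<in> A. f a = i} = h ` {x. x < n \<and> f (h x) = i}"
    using assms by (auto simp: bij_betw_def)
  moreover have "inj_on h {x. x < n \<and> f (h x) = i}"
    using assms by (auto simp: bij_betw_def intro: inj_on_subset)
  ultimately show ?thesis by (simp add: card_image)
qed

text \<open>List both sets in lexicographic order. Block indices increase along each list, so equal
  slice sizes force equal block indices at equal places, and matching places preserves keys.\<close>

lemma key_bijection_exists:
  assumes fin: "finite A" "finite B"
    and eq: "\<And>i. card {a \<in> A. blk a = i} = card {b \<in> B. blk b = i}"
  obtains g where "bij_betw g A B" "\<And>a b. a \<in> A \<Longrightarrow> b \<in> A \<Longrightarrow> key (g a) (g b) = key a b"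
proof -
  obtain h where h: "bij_betw h {..<card A} A"
    and kh: "\<And>x y. x < card A \<Longrightarrow> y < card A \<Longrightarrow>
        key (h x) (h y) = (blk (h x), blk (h y), x \<le> y, y \<le> x)"
    and mh: "\<And>x y. x \<le> y \<Longrightarrow> y < card A \<Longrightarrow> blk (h x) \<le> blk (h y)"
    using inflate_enumeration[OF fin(1)] by metis
  have [simp]: "card B = card A"
    using card_eq_if_card_fibres_eq[OF fin eq] by simp
  obtain h' where h': "bij_betw h' {..<card A} B"
    and kh': "\<And>x y. x < card A \<Longrightarrow> y < card A \<Longrightarrow>
        key (h' x) (h' y) = (blk (h' x), blk (h' y), x \<le> y, y \<le> x)"
    and mh': "\<And>x y. x \<le> y \<Longrightarrow> y < card A \<Longrightarrow> blk (h' x) \<le> blk (h' y)"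
    using inflate_enumeration[OF fin(2)] by (metis \<open>card B = card A\<close>)
  have blk: "blk (h x) = blk (h' x)" if "x < card A" for x
    using mono_eq_if_card_fibres_eq[of "card A" "\<lambda>x. blk (h x)" "\<lambda>x. blk (h' x)" x]
      mh mh' that eq card_fibre_bij[OF h, of blk] card_fibre_bij[OF h', of blk] by simp
  let ?k = "inv_into {..<card A} h"
  have k: "bij_betw ?k A {..<card A}" using h by (rule bij_betw_inv_into)
  show thesis
  proof (rule that)
    show "bij_betw (h' \<circ> ?k) A B" using k h' by (rule bij_betw_trans)
    fix a b assume "a \<in> A" "b \<in> A"
    then have "?k a < card A" "?k b < card A" "h (?k a) = a" "h (?k b) = b"
      using bij_betwE[OF k] bij_betw_inv_into_right[OF h] by auto
    then show "key ((h' \<circ> ?k) a) ((h' \<circ> ?k) b) = key a b"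
      using kh[of "?k a" "?k b"] kh'[of "?k a" "?k b"] blk[of "?k a"] blk[of "?k b"]
      by simp
  qed
qed

lemma has_monomorphic_decomposition_le_inflate:
  assumes "blk ` A \<subseteq> {..<m}"
  shows "has_monomorphic_decomposition_le (inflate q A) m"
  unfolding has_monomorphic_decomposition_le_iff
proof (intro exI[of _ blk] conjI)
  show "monomorphic_coloring (inflate q A) blk"
    unfolding monomorphic_coloring_def
  proof (intro allI impI, elim conjE)
    fix X Y assume *: "finite X" "X \<subseteq> elts (inflate q A)" "finite Y" "Y \<subseteq> elts (inflate q A)"
      "\<forall>i. card {a \<in> X. blk a = i} = card {a \<in> Y. blk a = i}"
    then obtain g where "bij_betw g X Y"
      "\<And>a b. a \<in> X \<Longrightarrow> b \<in> X \<Longrightarrow> key (g a) (g b) = key a b"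
      using key_bijection_exists[of X Y] by blast
    then show "isomorphic (restriction (inflate q A) X) (restriction (inflate q A) Y)"
      using * isomorphic_inflate[of g X Y] by (simp add: restriction_inflate inf.absorb2)
  qed
qed (use assms in simp)

section \<open>Levels: the intervals cut out by the bad positions\<close>

definition level :: "nat \<Rightarrow> nat rel list \<Rightarrow> nat \<Rightarrow> nat" where
  "level n \<rho> x = card (bad n \<rho> \<inter> {..<x})"

lemma level_mono: "x \<le> y \<Longrightarrow> level n \<rho> x \<le> level n \<rho> y"
  unfolding level_def by (intro card_mono) auto

lemma level_le: "level n \<rho> x \<le> card (bad n \<rho>)"
  unfolding level_def by (intro card_mono) auto

text \<open>Only bad positions strictly below a point are counted, so a bad \<open>x\<close> is the
  last point of its interval.\<close>

lemma level_Suc: "level n \<rho> (Suc x) = level n \<rho> x + (if x \<in> bad n \<rho> then 1 else 0)"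
proof -
  have "bad n \<rho> \<inter> {..<Suc x} =
      (if x \<in> bad n \<rho> then insert x (bad n \<rho> \<inter> {..<x}) else bad n \<rho> \<inter> {..<x})"
    by (auto simp: lessThan_Suc)
  then show ?thesis by (simp add: level_def)
qed

lemma level_eq_imp_not_bad:
  assumes "level n \<rho> x = level n \<rho> y" "x \<le> z" "z < y"
  shows "z \<notin> bad n \<rho>"
proof
  assume "z \<in> bad n \<rho>"
  then have "level n \<rho> z < level n \<rho> (Suc z)" by (simp add: level_Suc)
  moreover have "level n \<rho> x \<le> level n \<rho> z" "level n \<rho> (Suc z) \<le> level n \<rho> y"
    using assms(2,3) by (simp_all add: level_mono)
  ultimately show False using assms(1) by simp
qed

lemma not_badD:
  assumes "x \<notin> bad n \<rho>" "Suc x < n" "r \<in> set \<rho>"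
  shows "(x, x) \<in> r \<longleftrightarrow> (Suc x, Suc x) \<in> r"
    and "z < n \<Longrightarrow> z \<noteq> x \<Longrightarrow> z \<noteq> Suc x \<Longrightarrow>
           ((x, z) \<in> r \<longleftrightarrow> (Suc x, z) \<in> r) \<and> ((z, x) \<in> r \<longleftrightarrow> (z, Suc x) \<in> r)"
  using assms unfolding bad_def by blast+

text \<open>Walk from \<open>x\<close> to \<open>y\<close> in unit steps. No position passed is bad,
  so a step changes neither the loop nor the relations to a third point; \<open>z\<close> outside
  the interval from \<open>x\<close> to \<open>y\<close> remains a third point all along.\<close>

lemma same_level_aux:
  assumes "r \<in> set \<rho>" and "level n \<rho> x = level n \<rho> y" "x \<le> y" "y < n"
  shows "(x, x) \<in> r \<longleftrightarrow> (y, y) \<in> r"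
    and "z < n \<Longrightarrow> z < x \<or> y < z \<Longrightarrow>
           ((x, z) \<in> r \<longleftrightarrow> (y, z) \<in> r) \<and> ((z, x) \<in> r \<longleftrightarrow> (z, y) \<in> r)"
proof -
  have "((x, x) \<in> r \<longleftrightarrow> (y, y) \<in> r) \<and> (z < n \<and> (z < x \<or> y < z) \<longrightarrow>
           ((x, z) \<in> r \<longleftrightarrow> (y, z) \<in> r) \<and> ((z, x) \<in> r \<longleftrightarrow> (z, y) \<in> r))" for z
    using assms(3,2,4)
  proof (induction rule: dec_induct)
    case (step y)
    have "y \<notin> bad n \<rho>"
      using level_eq_imp_not_bad[OF step.prems(1) step.hyps(1)] by simp
    note nb = not_badD[OF this step.prems(2) assms(1)]
    have "level n \<rho> x = level n \<rho> y"
      using level_mono[of x y n \<rho>] level_mono[of y "Suc y" n \<rho>] step by simp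
    with step.IH step.prems
    have IH: "(x, x) \<in> r \<longleftrightarrow> (y, y) \<in> r" "z < n \<and> (z < x \<or> y < z) \<longrightarrow>
           ((x, z) \<in> r \<longleftrightarrow> (y, z) \<in> r) \<and> ((z, x) \<in> r \<longleftrightarrow> (z, y) \<in> r)"
      by auto
    show ?case
      using IH nb(1) nb(2)[of z] step.hyps by auto
  qed simp
  then show "(x, x) \<in> r \<longleftrightarrow> (y, y) \<in> r"
    "z < n \<Longrightarrow> z < x \<or> y < z \<Longrightarrow>
           ((x, z) \<in> r \<longleftrightarrow> (y, z) \<in> r) \<and> ((z, x) \<in> r \<longleftrightarrow> (z, y) \<in> r)"
    by blast+
qed

lemma same_level:
  assumes r: "r \<in> set \<rho>" and lev: "level n \<rho> x = level n \<rho> y" and n: "x < n" "y < n"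
  shows "(x, x) \<in> r \<longleftrightarrow> (y, y) \<in> r"
    and "z < n \<Longrightarrow> z < x \<and> z < y \<or> x < z \<and> y < z \<Longrightarrow>
           ((x, z) \<in> r \<longleftrightarrow> (y, z) \<in> r) \<and> ((z, x) \<in> r \<longleftrightarrow> (z, y) \<in> r)"
  using same_level_aux[OF r lev _ n(2)] same_level_aux[OF r lev[symmetric] _ n(1)]
  by (cases x y rule: le_cases; blast)+

lemma level_determines_relation:
  assumes r: "r \<in> set \<rho>" and lev: "level n \<rho> x = level n \<rho> x'" "level n \<rho> y = level n \<rho> y'"
    and n: "x < n" "x' < n" "y < n" "y' < n"
    and le: "x \<le> y \<longleftrightarrow> x' \<le> y'" "y \<le> x \<longleftrightarrow> y' \<le> x'"
  shows "(x, y) \<in> r \<longleftrightarrow> (x', y') \<in> r"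
proof -
  note sx = same_level[OF r lev(1) n(1,2)]
  note sy = same_level[OF r lev(2) n(3,4)]
  \<comment> \<open>The two points are replaced one after the other. The order of the replacements
    is chosen so that in each of them the fixed point lies on the same side of the old and the new
    point.\<close>
  consider "x = y" "x' = y'" | "x < y" "x' < y'" "y \<le> y'" | "x < y" "x' < y'" "y' \<le> y"
    | "y < x" "y' < x'" "y \<le> y'" | "y < x" "y' < x'" "y' \<le> y"
    using le by linarith
  then show ?thesis
  proof cases
    case 1 then show ?thesis using sx(1) by simp
  next
    case 2
    then show ?thesis using sy(2)[of x] sx(2)[of y'] n by auto
  next
    case 3
    then show ?thesis using sx(2)[of y] sy(2)[of x'] n by auto
  next
    case 4
    then show ?thesis using sx(2)[of y] sy(2)[of x'] n by auto
  next
    case 5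
    then show ?thesis using sy(2)[of x] sx(2)[of y'] n by auto
  qed
qed

definition level_key :: "nat \<Rightarrow> nat rel list \<Rightarrow> nat \<times> nat \<Rightarrow> key" where
  "level_key n \<rho> = (\<lambda>(x, y). (level n \<rho> x, level n \<rho> y, x \<le> y, y \<le> x))"

definition template :: "nat \<Rightarrow> nat rel list \<Rightarrow> key set list" where
  "template n \<rho> = map (\<lambda>r. level_key n \<rho> ` r) \<rho>"

text \<open>The position inside the block is \<open>x\<close> itself and need not start at 0: only
  the order of positions matters, and \<open>sizes\<close> later closes the gaps.\<close>

definition placement :: "nat \<Rightarrow> nat rel list \<Rightarrow> nat set" where
  "placement n \<rho> = (\<lambda>x. prod_encode (level n \<rho> x, x)) ` {..<n}"

text \<open>No pair outside \<open>r\<close> shares its key with a pair in \<open>r\<close>, by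
  \<open>level_determines_relation\<close>; hence the template loses no information.\<close>

lemma level_key_iff:
  assumes "ordered_binary_structure k (std n \<rho>)" "r \<in> set \<rho>" "x < n" "y < n"
  shows "level_key n \<rho> (x, y) \<in> level_key n \<rho> ` r \<longleftrightarrow> (x, y) \<in> r"
proof
  assume "level_key n \<rho> (x, y) \<in> level_key n \<rho> ` r"
  then obtain x' y' where *: "(x', y') \<in> r" "level_key n \<rho> (x, y) = level_key n \<rho> (x', y')"
    by auto
  moreover have "x' < n" "y' < n"
    using * assms(1,2) by (auto simp: ordered_binary_structure_std_iff)
  ultimately show "(x, y) \<in> r"
    using level_determines_relation[OF assms(2), of n x x' y y'] assms(3,4)
    by (simp add: level_key_def)
qed auto

lemma key_placement:
  "key (prod_encode (level n \<rho> x, x)) (prod_encode (level n \<rho> y, y)) = level_key n \<rho> (x, y)"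
proof -
  have "lexle (prod_encode (level n \<rho> x, x)) (prod_encode (level n \<rho> y, y)) \<longleftrightarrow> x \<le> y" for x y
  proof (cases "x \<le> y")
    case True
    then show ?thesis using level_mono[OF True, of n \<rho>] by (simp add: lexle_def le_less)
  next
    case False
    then show ?thesis using level_mono[of y x n \<rho>] by (simp add: lexle_def)
  qed
  then show ?thesis by (simp add: key_def level_key_def)
qed

lemma isomorphic_inflate_template:
  assumes "ordered_binary_structure k (std n \<rho>)"
  shows "isomorphic (std n \<rho>) (inflate (template n \<rho>) (placement n \<rho>))"
proof (rule isomorphic_stdI)
  show "bij_betw (\<lambda>x. prod_encode (level n \<rho> x, x)) {..<n}
      (elts (inflate (template n \<rho>) (placement n \<rho>)))"
    by (auto simp: bij_betw_def inj_on_def placement_def)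
  fix x y assume xy: "x < n" "y < n"
  have mem: "prod_encode (level n \<rho> x, x) \<in> placement n \<rho>" if "x < n" for x
    using that by (simp add: placement_def)
  show "(prod_encode (level n \<rho> x, x), prod_encode (level n \<rho> y, y))
       \<in> leq (inflate (template n \<rho>) (placement n \<rho>)) \<longleftrightarrow> x \<le> y"
    using xy mem key_placement[of n \<rho> x y] by (simp add: key_def level_key_def)
  fix i assume i: "i < length \<rho>"
  show "(x, y) \<in> \<rho> ! i \<longleftrightarrow> (prod_encode (level n \<rho> x, x), prod_encode (level n \<rho> y, y))
       \<in> rels (inflate (template n \<rho>) (placement n \<rho>)) ! i"
    using i xy mem level_key_iff[OF assms, of "\<rho> ! i" x y]
    by (simp add: key_placement template_def)
qed (simp add: template_def)

definition templates :: "nat \<Rightarrow> nat \<Rightarrow> key set list set" where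
  "templates k m = {q. set q \<subseteq> Pow ({..<m} \<times> {..<m} \<times> UNIV) \<and> length q = k}"

lemma finite_templates: "finite (templates k m)"
  unfolding templates_def by (rule finite_lists_length_eq) simp

lemma template_in_templates:
  assumes "ordered_binary_structure k (std n \<rho>)" "card (bad n \<rho>) < m"
  shows "template n \<rho> \<in> templates k m"
  using assms le_less_trans[OF level_le[of n \<rho>] assms(2)]
  by (auto simp: templates_def template_def level_key_def ordered_binary_structure_std_iff)

lemma blk_placement: "card (bad n \<rho>) < m \<Longrightarrow> blk ` placement n \<rho> \<subseteq> {..<m}"
  using le_less_trans[OF level_le[of n \<rho>]] by (auto simp: placement_def)

lemma has_monomorphic_decomposition_le_if_bad:
  assumes C: "hereditary_class k C" and bad: "\<And>n \<rho>. std n \<rho> \<in> C \<Longrightarrow> card (bad n \<rho>) < m"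
    and R: "R \<in> C"
  shows "has_monomorphic_decomposition_le R m"
proof -
  obtain \<rho> where \<rho>: "isomorphic (std (card (elts R)) \<rho>) R" "std (card (elts R)) \<rho> \<in> C"
    using hereditary_class_std_exists[OF C R] by metis
  let ?n = "card (elts R)"
  have "has_monomorphic_decomposition_le (inflate (template ?n \<rho>) (placement ?n \<rho>)) m"
    using blk_placement[OF bad[OF \<rho>(2)]] by (rule has_monomorphic_decomposition_le_inflate)
  then show ?thesis
    using isomorphic_inflate_template[OF hereditary_classD(1)[OF C \<rho>(2)]] \<rho>(1)
      has_monomorphic_decomposition_le_isomorphic isomorphic_sym by blast
qed

section \<open>Downsets of vectors\<close>

text \<open>A monotone subsequence is either nondecreasing already, or nonincreasing and then
  constant from the place where it attains its minimum.\<close>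

lemma nat_mono_subsequence:
  fixes x :: "nat \<Rightarrow> nat"
  obtains s :: "nat \<Rightarrow> nat" where "strict_mono s" "\<And>i j. i \<le> j \<Longrightarrow> x (s i) \<le> x (s j)"
proof -
  obtain s where s: "strict_mono s" "monoseq (\<lambda>n. x (s n))"
    using seq_monosub[of x] by auto
  show thesis
  proof (cases "\<forall>i j. i \<le> j \<longrightarrow> x (s i) \<le> x (s j)")
    case True
    then show thesis using that[of s] s(1) by blast
  next
    case False
    then have dec: "x (s j) \<le> x (s i)" if "i \<le> j" for i j
      using s(2) that unfolding monoseq_def by blast
    obtain N where N: "\<And>n. x (s N) \<le> x (s n)"
      using ex_has_least_nat[of "\<lambda>_. True" 0 "\<lambda>n. x (s n)"] by auto
    show thesis
    proof (rule that[of "\<lambda>n. s (N + n)"])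
      show "strict_mono (\<lambda>n. s (N + n))"
        using s(1) by (simp add: strict_mono_def)
      show "x (s (N + i)) \<le> x (s (N + j))" for i j
        using dec[of N "N + i"] N[of "N + j"] by simp
    qed
  qed
qed

text \<open>Induction on the dimension: pass to a subsequence that is good for the tails, then thin
  it out for the heads. The form with a whole nondecreasing subsequence, rather than one comparable
  pair, is what makes the second thinning possible.\<close>

lemma dickson:
  fixes w :: "nat \<Rightarrow> nat list"
  assumes "\<And>i. length (w i) = m"
  shows "\<exists>s :: nat \<Rightarrow> nat. strict_mono s \<and> (\<forall>i j. i \<le> j \<longrightarrow> list_all2 (\<le>) (w (s i)) (w (s j)))"
  using assms
proof (induction m arbitrary: w)
  case 0
  then show ?case by (auto intro!: exI[of _ id] simp: strict_mono_def)
next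
  case (Suc m)
  then have w: "w i = hd (w i) # tl (w i)" for i
    by (metis list.collapse list.size(3) nat.distinct(1))
  obtain s :: "nat \<Rightarrow> nat" where s: "strict_mono s"
    "\<And>i j. i \<le> j \<Longrightarrow> list_all2 (\<le>) (tl (w (s i))) (tl (w (s j)))"
    using Suc.IH[of "\<lambda>i. tl (w i)"] Suc.prems by auto
  obtain t :: "nat \<Rightarrow> nat" where t: "strict_mono t" "\<And>i j. i \<le> j \<Longrightarrow> hd (w (s (t i))) \<le> hd (w (s (t j)))"
    by (rule nat_mono_subsequence[of "\<lambda>i. hd (w (s i))"]) blast
  have "list_all2 (\<le>) (w (s (t i))) (w (s (t j)))" if "i \<le> j" for i j
  proof -
    have "t i \<le> t j" using that t(1) by (simp add: strict_mono_less_eq)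
    then show ?thesis
      using s(2) t(2)[OF that] by (subst w, subst (3) w) simp
  qed
  moreover have "strict_mono (s \<circ> t)"
    using s(1) t(1) by (rule strict_mono_o)
  ultimately show ?case by (intro exI[of _ "s \<circ> t"]) (simp add: o_def)
qed

definition downset :: "nat \<Rightarrow> nat list set \<Rightarrow> bool" where
  "downset m D \<longleftrightarrow> (\<forall>u \<in> D. length u = m) \<and> (\<forall>u \<in> D. \<forall>w. list_all2 (\<le>) w u \<longrightarrow> w \<in> D)"

lemma downset_chain_stabilizes:
  fixes D :: "nat \<Rightarrow> nat list set"
  assumes down: "\<And>j. downset m (D j)" and dec: "\<And>i j. i \<le> j \<Longrightarrow> D j \<subseteq> D i"
  shows "\<exists>J. \<forall>j\<ge>J. D j = D J"
proof (rule ccontr)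
  assume "\<not> ?thesis"
  then have "\<forall>J. \<exists>j w. j \<ge> J \<and> w \<in> D J \<and> w \<notin> D j"
    using dec by (metis subset_antisym subsetI)
  then obtain f w where f: "\<And>J. f J \<ge> J" "\<And>J. w J \<in> D J" "\<And>J. w J \<notin> D (f J)"
    by metis
  \<comment> \<open>Each \<open>w (a i)\<close> belongs to \<open>D (a i)\<close> and is lost by
    stage \<open>a (Suc i)\<close>. A later term above it would still lie in that stage and bring it
    back by downward closure.\<close>
  define a where "a i = (f ^^ i) 0" for i
  have a_Suc: "a (Suc i) = f (a i)" for i by (simp add: a_def)
  have a_mono: "a i \<le> a j" if "i \<le> j" for i j
    using that by (induction rule: dec_induct) (auto simp: a_Suc intro: order_trans f(1))
  have "length (w (a i)) = m" for i
    using f(2) down unfolding downset_def by blast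
  then obtain s :: "nat \<Rightarrow> nat" where s: "strict_mono s"
    "\<And>i j. i \<le> j \<Longrightarrow> list_all2 (\<le>) (w (a (s i))) (w (a (s j)))"
    using dickson[of "\<lambda>i. w (a i)" m] by blast
  have "Suc (s 0) \<le> s 1" using s(1) by (simp add: strict_mono_def Suc_le_eq)
  then have "w (a (s 1)) \<in> D (a (Suc (s 0)))"
    using f(2) dec a_mono by blast
  then have "w (a (s 0)) \<in> D (a (Suc (s 0)))"
    using down s(2)[of 0 1] unfolding downset_def by (meson zero_le_one)
  then show False using f(3) by (simp add: a_Suc)
qed

text \<open>Slicing by the first coordinate drives both later inductions on the dimension;
  stabilization leaves only finitely many different slices.\<close>

lemma downset_slices:
  assumes "downset (Suc m) D"
  shows "downset m {u. j # u \<in> D}"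
    and "i \<le> j \<Longrightarrow> {u. j # u \<in> D} \<subseteq> {u. i # u \<in> D}"
    and "\<exists>J. \<forall>j\<ge>J. {u. j # u \<in> D} = {u. J # u \<in> D}"
proof -
  show 1: "downset m {u. j # u \<in> D}" for j
    using assms unfolding downset_def by fastforce
  show 2: "i \<le> j \<Longrightarrow> {u. j # u \<in> D} \<subseteq> {u. i # u \<in> D}" for i j
  proof
    fix u assume "u \<in> {u. j # u \<in> D}" "i \<le> j"
    moreover have "list_all2 (\<le>) u u" by (simp add: list.rel_refl_strong)
    ultimately have "j # u \<in> D" "list_all2 (\<le>) (i # u) (j # u)" by simp_all
    then show "u \<in> {u. i # u \<in> D}" using assms unfolding downset_def by blast
  qed
  show "\<exists>J. \<forall>j\<ge>J. {u. j # u \<in> D} = {u. J # u \<in> D}"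
    by (rule downset_chain_stabilizes[of m]) (fact 1, fact 2)
qed

lemma downset_finite_union_of_boxes:
  assumes "downset m D"
  shows "\<exists>X :: enat list set. finite X \<and> (\<forall>a \<in> X. length a = m) \<and>
           D = {u. \<exists>a \<in> X. list_all2 (\<lambda>x y. enat x \<le> y) u a}"
  using assms
proof (induction m arbitrary: D)
  case 0
  show ?case
  proof (cases "D = {}")
    case True
    then show ?thesis by (intro exI[of _ "{}"]) auto
  next
    case False
    then have "D = {[]}" using 0 unfolding downset_def by auto
    then show ?thesis by (intro exI[of _ "{[]}"]) auto
  qed
next
  case (Suc m)
  define E where "E j = {u. j # u \<in> D}" for j
  have "\<exists>X :: enat list set. finite X \<and> (\<forall>a \<in> X. length a = m) \<and>
           E j = {u. \<exists>a \<in> X. list_all2 (\<lambda>x y. enat x \<le> y) u a}" for j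
    unfolding E_def by (rule Suc.IH, rule downset_slices[OF Suc.prems])
  then have "\<exists>X. \<forall>j. finite (X j) \<and> (\<forall>a \<in> X j. length a = m) \<and>
           E j = {u. \<exists>a \<in> X j. list_all2 (\<lambda>x y. enat x \<le> y) u a}"
    by (intro choice) blast
  then obtain X :: "nat \<Rightarrow> enat list set" where X': "\<forall>j. finite (X j) \<and>
      (\<forall>a \<in> X j. length a = m) \<and> E j = {u. \<exists>a \<in> X j. list_all2 (\<lambda>x y. enat x \<le> y) u a}"
    by (rule exE)
  have X: "finite (X j)" "a \<in> X j \<Longrightarrow> length a = m"
    "E j = {u. \<exists>a\<in>X j. list_all2 (\<lambda>x y. enat x \<le> y) u a}" for j a
    using X'[rule_format, of j] by blast+
  obtain J where J: "\<And>j. j \<ge> J \<Longrightarrow> E j = E J"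
    using downset_slices(3)[OF Suc.prems] unfolding E_def by blast
  have dec: "E j \<subseteq> E i" if "i \<le> j" for i j
    unfolding E_def using downset_slices(2)[OF Suc.prems that] .
  \<comment> \<open>Slices before \<open>J\<close> yield boxes capped in the first direction; the
    stable slice yields boxes unbounded in it. Capped boxes also contain smaller heads, which is
    harmless because slices shrink.\<close>
  define Y where "Y = (\<Union>j<J. (#) (enat j) ` X j) \<union> (#) \<infinity> ` X J"
  have mem: "j # u \<in> D \<longleftrightarrow> (\<exists>a \<in> Y. list_all2 (\<lambda>x y. enat x \<le> y) (j # u) a)" for j u
  proof
    assume "j # u \<in> D"
    then have u: "u \<in> E j" by (simp add: E_def)
    show "\<exists>a \<in> Y. list_all2 (\<lambda>x y. enat x \<le> y) (j # u) a"
    proof (cases "j < J")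
      case True
      obtain a where "a \<in> X j" "list_all2 (\<lambda>x y. enat x \<le> y) u a"
        using u X(3) by blast
      with True show ?thesis
        by (intro bexI[of _ "enat j # a"]) (auto simp: Y_def)
    next
      case False
      then obtain a where "a \<in> X J" "list_all2 (\<lambda>x y. enat x \<le> y) u a"
        using u X(3)[of J] J[of j] by auto
      then show ?thesis
        by (intro bexI[of _ "\<infinity> # a"]) (auto simp: Y_def)
    qed
  next
    assume "\<exists>a \<in> Y. list_all2 (\<lambda>x y. enat x \<le> y) (j # u) a"
    then consider i a where "i < J" "a \<in> X i" "j \<le> i" "list_all2 (\<lambda>x y. enat x \<le> y) u a"
      | a where "a \<in> X J" "list_all2 (\<lambda>x y. enat x \<le> y) u a"
      by (auto simp: Y_def)
    then have "u \<in> E j"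
    proof cases
      case (1 i a)
      then show ?thesis using X(3)[of i] dec[of j i] by auto
    next
      case (2 a)
      then have "u \<in> E J" using X(3)[of J] by auto
      then show ?thesis using dec[of j J] J[of j] by (cases "j \<le> J") auto
    qed
    then show "j # u \<in> D" by (simp add: E_def)
  qed
  have "D = {u. \<exists>a \<in> Y. list_all2 (\<lambda>x y. enat x \<le> y) u a}"
  proof (rule set_eqI)
    fix w
    show "w \<in> D \<longleftrightarrow> w \<in> {u. \<exists>a \<in> Y. list_all2 (\<lambda>x y. enat x \<le> y) u a}"
    proof (cases w)
      case Nil
      then show ?thesis
        using Suc.prems unfolding downset_def Y_def by auto
    next
      case (Cons j u)
      then show ?thesis using mem by simp
    qed
  qed
  moreover have "finite Y" "\<forall>a \<in> Y. length a = Suc m"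
    using X by (auto simp: Y_def)
  ultimately show ?case by blast
qed

section \<open>Eventually polynomial functions, real-valued to allow differences\<close>

definition evpoly :: "(nat \<Rightarrow> real) \<Rightarrow> bool" where
  "evpoly f \<longleftrightarrow> (\<exists>p :: real poly. \<forall>\<^sub>F n in sequentially. f n = poly p (real n))"

lemma evpolyI: "(\<And>n. n \<ge> N \<Longrightarrow> f n = poly p (real n)) \<Longrightarrow> evpoly f"
  unfolding evpoly_def eventually_sequentially by blast

lemma evpoly_cong: "evpoly f \<Longrightarrow> (\<And>n. n \<ge> N \<Longrightarrow> g n = f n) \<Longrightarrow> evpoly g"
  unfolding evpoly_def
  by (elim ex_forward, drule eventually_conj[OF eventually_ge_at_top[of N]])
    (auto elim: eventually_mono)

lemma evpoly_const: "evpoly (\<lambda>_. c)"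
  by (rule evpolyI[of 0 _ "[:c:]"]) simp

lemma evpoly_add:
  assumes "evpoly f" "evpoly g"
  shows "evpoly (\<lambda>n. f n + g n)"
proof -
  obtain p q where "\<forall>\<^sub>F n in sequentially. f n = poly p (real n)"
    "\<forall>\<^sub>F n in sequentially. g n = poly q (real n)"
    using assms unfolding evpoly_def by blast
  then have "\<forall>\<^sub>F n in sequentially. f n + g n = poly (p + q) (real n)"
    by eventually_elim simp
  then show ?thesis unfolding evpoly_def by blast
qed

lemma evpoly_cmult:
  assumes "evpoly f"
  shows "evpoly (\<lambda>n. c * f n)"
proof -
  obtain p where "\<forall>\<^sub>F n in sequentially. f n = poly p (real n)"
    using assms unfolding evpoly_def by blast
  then have "\<forall>\<^sub>F n in sequentially. c * f n = poly (smult c p) (real n)"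
    by eventually_elim simp
  then show ?thesis unfolding evpoly_def by blast
qed

lemma evpoly_diff:
  assumes "evpoly f" "evpoly g"
  shows "evpoly (\<lambda>n. f n - g n)"
  using evpoly_add[OF assms(1) evpoly_cmult[OF assms(2), of "-1"]] by simp

lemma evpoly_sum: "(\<And>i. i \<in> I \<Longrightarrow> evpoly (f i)) \<Longrightarrow> evpoly (\<lambda>n. \<Sum>i\<in>I. f i n)"
  by (induction I rule: infinite_finite_induct) (simp_all add: evpoly_const evpoly_add)

lemma evpoly_shift:
  assumes "evpoly f"
  shows "evpoly (\<lambda>n. f (n - j))"
proof -
  obtain p N where N: "\<And>n. n \<ge> N \<Longrightarrow> f n = poly p (real n)"
    using assms unfolding evpoly_def eventually_sequentially by blast
  show ?thesis
  proof (rule evpolyI)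
    fix n assume "n \<ge> N + j"
    then have "n - j \<ge> N" "real (n - j) = real n - real j" by (simp_all add: of_nat_diff)
    then show "f (n - j) = poly (pcompose p [:- real j, 1:]) (real n)"
      using N by (simp add: poly_pcompose)
  qed
qed

text \<open>Telescope \<open>(i + 1) ^ (d + 1) - i ^ (d + 1)\<close>, expand binomially, and solve
  for the sum of \<open>d\<close>-th powers in terms of the sums of lower powers.\<close>

lemma sum_of_powers_poly: "\<exists>P :: real poly. \<forall>n. (\<Sum>i\<le>n. real i ^ d) = poly P (real n)"
proof (induction d rule: less_induct)
  case (less d)
  then obtain P where P: "\<And>j n. j < d \<Longrightarrow> (\<Sum>i\<le>n. real i ^ j) = poly (P j) (real n)" by metis
  define Q where "Q = smult (1 / (real d + 1))
    ([:1, 1:] ^ (d + 1) - (\<Sum>j<d. smult (real (Suc d choose j)) (P j)))"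
  have "(\<Sum>i\<le>n. real i ^ d) = poly Q (real n)" for n
  proof -
    have "real (Suc n) ^ Suc d = (\<Sum>i\<le>n. real (Suc i) ^ Suc d - real i ^ Suc d)"
      by (induction n) auto
    also have "\<dots> = (\<Sum>i\<le>n. \<Sum>j\<le>d. real (Suc d choose j) * real i ^ j)"
    proof (rule sum.cong[OF refl])
      fix i
      have "real (Suc i) ^ Suc d = (real i + 1) ^ Suc d" by (simp add: add.commute)
      also have "\<dots> = (\<Sum>j\<le>Suc d. real (Suc d choose j) * real i ^ j)"
        by (subst binomial_ring) simp
      also have "\<dots> = (\<Sum>j\<le>d. real (Suc d choose j) * real i ^ j) + real i ^ Suc d"
        by simp
      finally show "real (Suc i) ^ Suc d - real i ^ Suc d =
          (\<Sum>j\<le>d. real (Suc d choose j) * real i ^ j)" by simp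
    qed
    also have "\<dots> = (\<Sum>j\<le>d. \<Sum>i\<le>n. real (Suc d choose j) * real i ^ j)"
      by (rule sum.swap)
    also have "\<dots> = (\<Sum>j\<le>d. real (Suc d choose j) * (\<Sum>i\<le>n. real i ^ j))"
      by (simp add: sum_distrib_left)
    also have "\<dots> = (\<Sum>j<d. real (Suc d choose j) * poly (P j) (real n)) +
        (real d + 1) * (\<Sum>i\<le>n. real i ^ d)"
    proof -
      have "{..d} = insert d {..<d}" by auto
      then show ?thesis by (simp add: P add.commute)
    qed
    finally have "(real d + 1) * (\<Sum>i\<le>n. real i ^ d) =
        (real n + 1) ^ Suc d - (\<Sum>j<d. real (Suc d choose j) * poly (P j) (real n))"
      by (simp add: add.commute)
    then have "(\<Sum>i\<le>n. real i ^ d) =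
        ((real n + 1) ^ Suc d - (\<Sum>j<d. real (Suc d choose j) * poly (P j) (real n))) / (real d + 1)"
      by (metis add.commute nonzero_mult_div_cancel_left of_nat_Suc of_nat_neq_0)
    also have "\<dots> = poly Q (real n)"
      by (simp add: Q_def poly_sum) (simp add: field_simps)
    finally show ?thesis .
  qed
  then show ?case by blast
qed

lemma evpoly_partial_sums:
  assumes "evpoly f"
  shows "evpoly (\<lambda>n. \<Sum>i\<le>n. f i)"
proof -
  obtain p N where N: "\<And>n. n \<ge> N \<Longrightarrow> f n = poly p (real n)"
    using assms unfolding evpoly_def eventually_sequentially by blast
  have "evpoly (\<lambda>n. \<Sum>i\<le>n. real i ^ d)" for d
    using sum_of_powers_poly[of d] by (auto intro: evpolyI)
  then have "evpoly (\<lambda>n. \<Sum>d\<le>degree p. coeff p d * (\<Sum>i\<le>n. real i ^ d))"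
    by (intro evpoly_sum evpoly_cmult)
  moreover have "(\<Sum>d\<le>degree p. coeff p d * (\<Sum>i\<le>n. real i ^ d)) = (\<Sum>i\<le>n. poly p (real i))" for n
    by (simp add: poly_altdef sum_distrib_left) (rule sum.swap)
  \<comment> \<open>Below \<open>N\<close> the function may differ from its polynomial; in the
    partial sums this is a constant correction once \<open>n \<ge> N\<close>.\<close>
  ultimately have *: "evpoly (\<lambda>n. (\<Sum>i\<le>n. poly p (real i)) + (\<Sum>i<N. f i - poly p (real i)))"
    by (intro evpoly_add evpoly_const) simp
  show ?thesis
  proof (rule evpoly_cong[OF *])
    fix n assume "n \<ge> N"
    have "(\<Sum>i\<le>n. f i - poly p (real i)) = (\<Sum>i<N. f i - poly p (real i))"
      by (rule sum.mono_neutral_right) (use \<open>n \<ge> N\<close> N in auto)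
    then show "(\<Sum>i\<le>n. f i) = (\<Sum>i\<le>n. poly p (real i)) + (\<Sum>i<N. f i - poly p (real i))"
      by (simp add: sum_subtractf)
  qed
qed

section \<open>Counting the points of a downset by coordinate sum\<close>

lemma finite_lists_sum:
  assumes "\<And>u. u \<in> D \<Longrightarrow> length u = m"
  shows "finite {u \<in> D. sum_list u = (n :: nat)}"
proof (rule finite_subset)
  show "{u \<in> D. sum_list u = n} \<subseteq> {u. set u \<subseteq> {..n} \<and> length u = m}"
    using assms member_le_sum_list by auto
  show "finite {u :: nat list. set u \<subseteq> {..n} \<and> length u = m}"
    by (rule finite_lists_length_eq) simp
qed

lemma evpoly_downset_count:
  assumes "downset m D"
  shows "evpoly (\<lambda>n. real (card {u \<in> D. sum_list u = n}))"
  using assms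
proof (induction m arbitrary: D)
  case 0
  then have "{u \<in> D. sum_list u = n} = {}" if "n \<ge> 1" for n
    using that unfolding downset_def by auto
  then show ?case
    by (intro evpoly_cong[OF evpoly_const[of 0], of 1]) (simp only: card.empty of_nat_0)
next
  case (Suc m)
  define E where "E j = {u. j # u \<in> D}" for j
  define c where "c j n = real (card {u \<in> E j. sum_list u = n})" for j n
  have c: "evpoly (c j)" for j
    unfolding c_def E_def by (rule Suc.IH, rule downset_slices[OF Suc.prems])
  obtain J where J: "\<And>j. j \<ge> J \<Longrightarrow> E j = E J"
    using downset_slices(3)[OF Suc.prems] unfolding E_def by blast
  \<comment> \<open>Heads below \<open>J\<close> contribute shifted counts of their slices. All
    heads from \<open>J\<close> on share the slice \<open>E J\<close>, whose counts add up to a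
    partial sum over the remaining totals \<open>0, ..., n - J\<close>.\<close>
  have "evpoly (\<lambda>n. (\<Sum>j<J. c j (n - j)) + (\<Sum>i\<le>n - J. c J i))"
    by (intro evpoly_add evpoly_sum evpoly_shift[of _ ] c evpoly_shift[OF evpoly_partial_sums[OF c]])
  then show ?case
  proof (rule evpoly_cong)
    fix n assume "n \<ge> J"
    have len: "length u = m" if "u \<in> E j" for u j
      using that Suc.prems by (auto simp: E_def downset_def)
    have "{u \<in> D. sum_list u = n} = (\<Union>j\<le>n. (#) j ` {u \<in> E j. sum_list u = n - j})"
    proof (intro equalityI subsetI)
      fix w assume w: "w \<in> {u \<in> D. sum_list u = n}"
      then obtain j u where "w = j # u"
        using Suc.prems by (cases w) (auto simp: downset_def)
      with w show "w \<in> (\<Union>j\<le>n. (#) j ` {u \<in> E j. sum_list u = n - j})"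
        by (auto simp: E_def intro!: bexI[of _ j])
    qed (auto simp: E_def)
    moreover have "card (\<Union>j\<le>n. (#) j ` {u \<in> E j. sum_list u = n - j}) =
        (\<Sum>j\<le>n. card ((#) j ` {u \<in> E j. sum_list u = n - j}))"
    proof (intro card_UN_disjoint ballI impI)
      show "finite ((#) j ` {u \<in> E j. sum_list u = n - j})" for j
        using finite_lists_sum[OF len] by (rule finite_imageI)
    qed auto
    ultimately have "card {u \<in> D. sum_list u = n} =
        (\<Sum>j\<le>n. card ((#) j ` {u \<in> E j. sum_list u = n - j}))"
      by (rule trans[OF arg_cong[of _ _ card]])
    then have "real (card {u \<in> D. sum_list u = n}) = (\<Sum>j\<le>n. c j (n - j))"
      by (simp add: card_image c_def)
    also have "{..n} = {..<J} \<union> {J..n}" using \<open>n \<ge> J\<close> by auto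
    also have "(\<Sum>j\<in>{..<J} \<union> {J..n}. c j (n - j)) =
        (\<Sum>j<J. c j (n - j)) + (\<Sum>j\<in>{J..n}. c j (n - j))"
      by (rule sum.union_disjoint) auto
    also have "(\<Sum>j\<in>{J..n}. c j (n - j)) = (\<Sum>j\<in>{J..n}. c J (n - j))"
    proof (rule sum.cong[OF refl])
      fix j assume "j \<in> {J..n}"
      then have "E j = E J" by (intro J) simp
      then show "c j (n - j) = c J (n - j)" by (simp add: c_def)
    qed
    also have "\<dots> = (\<Sum>i\<le>n - J. c J i)"
      by (rule sum.reindex_bij_witness[of _ "\<lambda>i. n - i" "\<lambda>j. n - j"]) (use \<open>n \<ge> J\<close> in auto)
    finally show "real (card {u \<in> D. sum_list u = n}) =
        (\<Sum>j<J. c j (n - j)) + (\<Sum>i\<le>n - J. c J i)" .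
  qed
qed

section \<open>Finite unions of ages\<close>

text \<open>An entry \<open>\<infinity>\<close> gives an infinite block; boxes of downsets thus
  become infinite structures.\<close>

definition box :: "enat list \<Rightarrow> nat set" where
  "box a = {b. blk b < length a \<and> enat (pos b) < a ! blk b}"

abbreviation nbox :: "nat list \<Rightarrow> nat set" where
  "nbox v \<equiv> box (map enat v)"

lemma box_slice: "i < length a \<Longrightarrow> {b \<in> box a. blk b = i} = (\<lambda>t. prod_encode (i, t)) ` {t. enat t < a ! i}"
proof (intro equalityI subsetI)
  fix b assume "i < length a" "b \<in> {b \<in> box a. blk b = i}"
  moreover have "b = prod_encode (blk b, pos b)" by (simp add: blk_def pos_def)
  ultimately show "b \<in> (\<lambda>t. prod_encode (i, t)) ` {t. enat t < a ! i}"
    by (auto simp: box_def intro!: image_eqI[of _ _ "pos b"])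
qed (auto simp: box_def)

lemma card_prod_encode_slice: "card ((\<lambda>t. prod_encode (i, t)) ` A) = card A"
  by (intro card_image inj_onI) simp

lemma card_nbox_slice: "i < length v \<Longrightarrow> card {b \<in> nbox v. blk b = i} = v ! i"
  by (simp add: box_slice card_prod_encode_slice)

lemma finite_nbox [simp]: "finite (nbox v)"
proof -
  have "nbox v = (\<Union>i<length v. {b \<in> nbox v. blk b = i})"
    by (auto simp: box_def)
  also have "finite \<dots>"
    by (intro finite_UN_I) (auto simp: box_slice)
  finally show ?thesis .
qed

lemma card_nbox: "card (nbox v) = sum_list v"
proof -
  have "card (nbox v) = card (\<Union>i<length v. {b \<in> nbox v. blk b = i})"
    by (rule arg_cong[of _ _ card]) (auto simp: box_def)
  also have "\<dots> = (\<Sum>i<length v. card {b \<in> nbox v. blk b = i})"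
    by (intro card_UN_disjoint) auto
  also have "\<dots> = (\<Sum>i<length v. v ! i)"
    by (simp add: card_nbox_slice)
  finally show ?thesis by (simp add: sum_list_sum_nth atLeast0LessThan)
qed

lemma nbox_subset_box: "list_all2 (\<lambda>x y. enat x \<le> y) u a \<Longrightarrow> nbox u \<subseteq> box a"
  by (auto simp: box_def list_all2_conv_all_nth intro: less_le_trans)

lemma nbox_mono: "list_all2 (\<le>) u v \<Longrightarrow> nbox u \<subseteq> nbox v"
  by (rule nbox_subset_box) (simp add: list_all2_conv_all_nth)

definition sizes :: "nat \<Rightarrow> nat set \<Rightarrow> nat list" where
  "sizes m A = map (\<lambda>i. card {b \<in> A. blk b = i}) [0..<m]"

lemma length_sizes [simp]: "length (sizes m A) = m"
  by (simp add: sizes_def)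

lemma sizes_le_box:
  assumes "A \<subseteq> box a"
  shows "list_all2 (\<lambda>x y. enat x \<le> y) (sizes (length a) A) a"
proof -
  have "enat (card {b \<in> A. blk b = i}) \<le> a ! i" if i: "i < length a" for i
  proof (cases "a ! i")
    case (enat n)
    have "{b \<in> A. blk b = i} \<subseteq> (\<lambda>t. prod_encode (i, t)) ` {..<n}"
      using assms box_slice[OF i] enat by auto
    then have "card {b \<in> A. blk b = i} \<le> card ((\<lambda>t. prod_encode (i, t)) ` {..<n})"
      by (intro card_mono) auto
    then show ?thesis by (simp add: card_prod_encode_slice enat)
  qed simp
  then show ?thesis by (simp add: list_all2_conv_all_nth sizes_def)
qed

lemma card_slice_sizes:
  assumes "blk ` A \<subseteq> {..<m}"
  shows "card {b \<in> A. blk b = i} = card {b \<in> nbox (sizes m A). blk b = i}"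
proof (cases "i < m")
  case True
  then show ?thesis by (subst card_nbox_slice) (simp_all add: sizes_def)
next
  case False
  then have "{b \<in> A. blk b = i} = {}" "{b \<in> nbox (sizes m A). blk b = i} = {}"
    using assms by (auto simp: box_def)
  then show ?thesis by (simp only:)
qed

text \<open>Inflations depend only on block sizes, so gaps between positions can be closed.\<close>

lemma isomorphic_inflate_nbox_sizes:
  assumes "finite A" "blk ` A \<subseteq> {..<m}"
  shows "isomorphic (inflate q A) (inflate q (nbox (sizes m A)))"
  using key_bijection_exists[OF assms(1) finite_nbox card_slice_sizes[OF assms(2)]]
    isomorphic_inflate by metis

definition codes :: "nat ordbin set \<Rightarrow> nat \<Rightarrow> key set list \<Rightarrow> nat list set" where
  "codes C m q = {v. length v = m \<and> inflate q (nbox v) \<in> C}"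

lemma downset_codes:
  assumes "hereditary_class k C"
  shows "downset m (codes C m q)"
  unfolding downset_def
proof (intro conjI ballI allI impI)
  fix u w assume u: "u \<in> codes C m q" and le: "list_all2 (\<le>) w u"
  have "restriction (inflate q (nbox u)) (nbox w) \<in> C"
    using u nbox_mono[OF le] by (intro hereditary_class_restriction[OF assms]) (auto simp: codes_def)
  then show "w \<in> codes C m q"
    using u le nbox_mono[OF le]
    by (auto simp: codes_def restriction_inflate inf.absorb2 dest: list_all2_lengthD)
qed (simp add: codes_def)

text \<open>A finite part of the box, once its gaps are closed, has a size vector bounded by
  \<open>a\<close>, hence one of the given codes.\<close>

lemma age_inflate_box_subset:
  assumes C: "hereditary_class k C"
    and codes: "\<And>u. list_all2 (\<lambda>x y. enat x \<le> y) u a \<Longrightarrow> u \<in> codes C (length a) q"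
  shows "age k (inflate q (box a)) \<subseteq> C"
proof
  fix S assume "S \<in> age k (inflate q (box a))"
  then obtain A where S: "ordered_binary_structure k S" and A: "A \<subseteq> box a" "finite A"
    and iso: "isomorphic (inflate q A) S"
    by (auto simp: age_def restriction_inflate inf.absorb2)
  have "blk ` A \<subseteq> {..<length a}" using A by (auto simp: box_def)
  then have "isomorphic (inflate q (nbox (sizes (length a) A))) (inflate q A)"
    using isomorphic_inflate_nbox_sizes[OF A(2)] isomorphic_sym by blast
  moreover have "inflate q (nbox (sizes (length a) A)) \<in> C"
    using codes[OF sizes_le_box[OF A(1)]] by (simp add: codes_def)
  ultimately show "S \<in> C"
    using hereditary_class_isomorphic[OF C _ S] isomorphic_trans[OF _ iso] by blast
qed

text \<open>Every restriction to a finite initial segment of the natural numbers has a suitable colouring;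
  by the pigeonhole principle infinitely many of these agree with a limit colouring on any given
  initial segment.\<close>

lemma has_monomorphic_decomposition_le_compact:
  fixes S :: "nat ordbin"
  assumes "\<And>A. A \<subseteq> elts S \<Longrightarrow> finite A \<Longrightarrow> has_monomorphic_decomposition_le (restriction S A) m"
  shows "has_monomorphic_decomposition_le S m"
proof -
  have "\<exists>f. f ` (elts S \<inter> {..<n}) \<subseteq> {..<m} \<and>
      monomorphic_coloring (restriction S (elts S \<inter> {..<n})) f" for n
    using assms[of "elts S \<inter> {..<n}"] unfolding has_monomorphic_decomposition_le_iff by simp
  then have "\<exists>f. \<forall>n. f n ` (elts S \<inter> {..<n}) \<subseteq> {..<m} \<and>
      monomorphic_coloring (restriction S (elts S \<inter> {..<n})) (f n)"
    by (intro choice) blast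
  then obtain f where f_range: "\<And>n. f n ` (elts S \<inter> {..<n}) \<subseteq> {..<m}"
    and f_mono: "\<And>n. monomorphic_coloring (restriction S (elts S \<inter> {..<n})) (f n)"
    by blast
  \<comment> \<open>The default 0 makes \<open>g n\<close> total with values in a fixed finite set;
    that set is \<open>{..m}\<close> because \<open>0 < m\<close> is not known.\<close>
  define g where "g n x = (if x \<in> elts S \<inter> {..<n} then f n x else 0)" for n x
  have g_range: "g n x \<in> {..m}" for n x
    using f_range[of n] by (auto simp: g_def)
  have "\<exists>F. \<forall>N. infinite {n. \<forall>x<N. g n x = F N x} \<and> (\<forall>x<N. F (Suc N) x = F N x)"
  proof (rule dependent_nat_choice)
    show "\<exists>h. infinite {n. \<forall>x<0. g n x = h x}" by simp
    fix h N assume inf: "infinite {n. \<forall>x<N. g n x = h x}" (is "infinite ?A")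
    have "finite ((\<lambda>n. g n N) ` ?A)"
      by (rule finite_subset[of _ "{..m}"]) (use g_range in auto)
    then obtain y where "infinite {n \<in> ?A. g n N = y}"
      using pigeonhole_infinite[OF inf, of "\<lambda>n. g n N"] by blast
    moreover have "{n \<in> ?A. g n N = y} = {n. \<forall>x<Suc N. g n x = (h(N := y)) x}"
      by (auto simp: less_Suc_eq)
    ultimately show "\<exists>h'. infinite {n. \<forall>x<Suc N. g n x = h' x} \<and> (\<forall>x<N. h' x = h x)"
      by (intro exI[of _ "h(N := y)"]) auto
  qed
  then obtain F where F: "\<And>N. infinite {n. \<forall>x<N. g n x = F N x}"
    and F_Suc: "\<And>N x. x < N \<Longrightarrow> F (Suc N) x = F N x" by blast
  define c where "c x = F (Suc x) x" for x
  have c: "F N x = c x" if "x < N" for N x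
  proof -
    have "Suc x \<le> N" using that by simp
    then show ?thesis
      by (induction rule: dec_induct) (auto simp: c_def F_Suc)
  qed
  \<comment> \<open>An infinite set of indices contains one with \<open>n \<ge> N\<close>, and for
    such \<open>n\<close> the default value does not interfere below \<open>N\<close>.\<close>
  have limit: "\<exists>n\<ge>N. \<forall>x \<in> elts S \<inter> {..<N}. f n x = c x" for N
  proof -
    obtain n where n: "n \<ge> N" "\<forall>x<N. g n x = F N x"
      using F[of N] unfolding infinite_nat_iff_unbounded_le by blast
    then have "f n x = c x" if "x \<in> elts S \<inter> {..<N}" for x
      using that c[of x N] by (auto simp: g_def split: if_splits)
    with n show ?thesis by blast
  qed
  show ?thesis
    unfolding has_monomorphic_decomposition_le_iff
  proof (intro exI[of _ c] conjI)
    show "c ` elts S \<subseteq> {..<m}"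
    proof clarify
      fix x assume x: "x \<in> elts S"
      obtain n where "n \<ge> Suc x" "f n x = c x" using limit[of "Suc x"] x by auto
      then have "c x \<in> f n ` (elts S \<inter> {..<n})" using x by (intro image_eqI[of _ _ x]) auto
      then show "c x < m" using f_range[of n] by blast
    qed
    show "monomorphic_coloring S c"
      unfolding monomorphic_coloring_def
    proof (intro allI impI, elim conjE)
      fix A B assume A: "finite A" "A \<subseteq> elts S" and B: "finite B" "B \<subseteq> elts S"
        and eq: "\<forall>i. card {a \<in> A. c a = i} = card {a \<in> B. c a = i}"
      obtain N where N: "A \<union> B \<subseteq> {..<N}"
        using A B finite_nat_iff_bounded[of "A \<union> B"] by auto
      obtain n where n: "n \<ge> N" "\<forall>x \<in> elts S \<inter> {..<N}. f n x = c x" using limit by blast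
      have fc: "f n a = c a" if "a \<in> A \<union> B" for a
        using n(2) that A B N by blast
      have sub: "A \<subseteq> elts S \<inter> {..<n}" "B \<subseteq> elts S \<inter> {..<n}"
        using A B N n(1) by auto
      have "{a \<in> A. f n a = i} = {a \<in> A. c a = i}" "{a \<in> B. f n a = i} = {a \<in> B. c a = i}" for i
        using fc by auto
      then have "isomorphic (restriction (restriction S (elts S \<inter> {..<n})) A)
          (restriction (restriction S (elts S \<inter> {..<n})) B)"
        using f_mono[of n] A B eq sub unfolding monomorphic_coloring_def by auto
      then show "isomorphic (restriction S A) (restriction S B)"
        using sub by (simp add: inf.absorb2)
    qed
  qed
qed

lemma hereditary_class_finite_union_of_ages:
  assumes C: "hereditary_class k C" and bad: "\<And>n \<rho>. std n \<rho> \<in> C \<Longrightarrow> card (bad n \<rho>) < m"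
  shows "\<exists>F. finite F \<and> (\<forall>S \<in> F. ordered_binary_structure k S) \<and> C = (\<Union>S \<in> F. age k S)"
proof -
  have "\<exists>X. \<forall>q. finite (X q) \<and> (\<forall>a \<in> X q. length a = m) \<and>
      codes C m q = {u. \<exists>a \<in> X q. list_all2 (\<lambda>x y. enat x \<le> y) u a}"
    using downset_finite_union_of_boxes[OF downset_codes[OF C]] by (intro choice) blast
  then obtain X :: "key set list \<Rightarrow> enat list set" where X: "\<forall>q. finite (X q) \<and>
      (\<forall>a \<in> X q. length a = m) \<and>
      codes C m q = {u. \<exists>a \<in> X q. list_all2 (\<lambda>x y. enat x \<le> y) u a}"
    by (rule exE)
  define F where "F = (\<Union>q \<in> templates k m. (\<lambda>a. inflate q (box a)) ` X q)"
  have finF: "finite F"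
    unfolding F_def using X finite_templates by blast
  have ord: "\<forall>S \<in> F. ordered_binary_structure k S"
    by (auto simp: F_def templates_def intro: ordered_binary_structure_inflate)
  have sub: "age k S \<subseteq> C" if "S \<in> F" for S
  proof -
    obtain q a where S: "S = inflate q (box a)" and a: "a \<in> X q"
      using \<open>S \<in> F\<close> by (auto simp: F_def)
    have "length a = m" using X a by blast
    moreover have "u \<in> codes C m q" if "list_all2 (\<lambda>x y. enat x \<le> y) u a" for u
      using X a that by blast
    ultimately show ?thesis
      unfolding S by (intro age_inflate_box_subset[OF C]) simp
  qed
  have sup: "\<exists>S \<in> F. R \<in> age k S" if R: "R \<in> C" for R
  proof -
    let ?n = "card (elts R)"
    obtain \<rho> where iso: "isomorphic (std ?n \<rho>) R" and mem: "std ?n \<rho> \<in> C"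
      using hereditary_class_std_exists[OF C R] by metis
    let ?q = "template ?n \<rho>"
    \<comment> \<open>Vectors of the common length \<open>m\<close> serve all members: levels that
      do not occur become empty blocks, which are allowed here.\<close>
    let ?v = "sizes m (placement ?n \<rho>)"
    have obs: "ordered_binary_structure k (std ?n \<rho>)" using hereditary_classD(1)[OF C mem] .
    have q: "?q \<in> templates k m" using template_in_templates[OF obs bad[OF mem]] .
    have "isomorphic (std ?n \<rho>) (inflate ?q (nbox ?v))"
      using isomorphic_trans[OF isomorphic_inflate_template[OF obs]
          isomorphic_inflate_nbox_sizes[OF _ blk_placement[OF bad[OF mem]]]]
      by (simp add: placement_def)
    then have iso': "isomorphic (inflate ?q (nbox ?v)) R"
      using isomorphic_trans[OF isomorphic_sym iso] by blast
    have "inflate ?q (nbox ?v) \<in> C"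
      using hereditary_class_isomorphic[OF C R _ isomorphic_sym[OF iso']]
        ordered_binary_structure_inflate q by (auto simp: templates_def)
    then have "?v \<in> codes C m ?q" by (simp add: codes_def)
    then obtain a where a: "a \<in> X ?q" "list_all2 (\<lambda>x y. enat x \<le> y) ?v a" using X by blast
    have "R \<in> age k (inflate ?q (box a))"
      unfolding age_def
    proof (intro CollectI conjI exI[of _ "nbox ?v"])
      show "ordered_binary_structure k R" using hereditary_classD(1)[OF C R] .
      show "nbox ?v \<subseteq> elts (inflate ?q (box a))" using nbox_subset_box[OF a(2)] by simp
      show "isomorphic (restriction (inflate ?q (box a)) (nbox ?v)) R"
        using iso' nbox_subset_box[OF a(2)] by (simp add: restriction_inflate inf.absorb2)
    qed simp
    moreover have "inflate ?q (box a) \<in> F" using q a(1) unfolding F_def by blast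
    ultimately show ?thesis by blast
  qed
  have "C = (\<Union>S \<in> F. age k S)"
    using sub sup by (intro equalityI subsetI UN_least) auto
  with finF ord show ?thesis by blast
qed

lemma has_monomorphic_decomposition_le_if_age:
  assumes "ordered_binary_structure k S" "\<And>R. R \<in> age k S \<Longrightarrow> has_monomorphic_decomposition_le R m"
  shows "has_monomorphic_decomposition_le S m"
proof (rule has_monomorphic_decomposition_le_compact)
  fix A assume "A \<subseteq> elts S" "finite A"
  then have "restriction S A \<in> age k S"
    using ordered_binary_structure_restriction[OF assms(1)] by (auto simp: age_def)
  then show "has_monomorphic_decomposition_le (restriction S A) m" by (rule assms(2))
qed

section \<open>Counting canonical codes\<close>

text \<open>The template's version of a bad position at the border of blocks \<open>i\<close> and
  \<open>Suc i\<close>. The condition on \<open>lexle\<close> keeps \<open>z\<close> on one side of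
  both points; otherwise keys could differ merely because \<open>z\<close> lies between
  them.\<close>

definition separated :: "key set list \<Rightarrow> nat set \<Rightarrow> nat \<Rightarrow> bool" where
  "separated q T i \<longleftrightarrow> (\<exists>a \<in> T. \<exists>b \<in> T. blk a = i \<and> blk b = Suc i \<and> (\<exists>Q \<in> set q.
     (key a a \<in> Q) \<noteq> (key b b \<in> Q) \<or>
     (\<exists>z \<in> T. z \<noteq> a \<and> z \<noteq> b \<and> lexle z a = lexle z b \<and>
        ((key a z \<in> Q) \<noteq> (key b z \<in> Q) \<or> (key z a \<in> Q) \<noteq> (key z b \<in> Q)))))"

text \<open>The pair \<open>(q, v)\<close> is canonical when \<open>q\<close> has no unused keys and the blocks cannot be merged.
  Both conditions are existential, so they survive an increase of \<open>v\<close>.\<close>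

definition canonical :: "key set list \<Rightarrow> nat list \<Rightarrow> bool" where
  "canonical q v \<longleftrightarrow>
     (\<forall>Q \<in> set q. \<forall>\<kappa> \<in> Q. \<exists>a \<in> nbox v. \<exists>b \<in> nbox v. \<kappa> = key a b) \<and>
     (\<forall>i. Suc i < length v \<longrightarrow> separated q (nbox v) i)"

lemma separated_mono: "separated q S i \<Longrightarrow> S \<subseteq> T \<Longrightarrow> separated q T i"
  unfolding separated_def by blast

lemma canonical_mono:
  assumes "canonical q u" "list_all2 (\<le>) u v"
  shows "canonical q v"
proof -
  have sub: "nbox u \<subseteq> nbox v" and len: "length u = length v"
    using assms(2) nbox_mono by (auto dest: list_all2_lengthD)
  show ?thesis
    using assms(1) separated_mono[OF _ sub] unfolding canonical_def len
    by (meson sub subset_iff)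
qed

lemma level_0 [simp]: "level n \<rho> 0 = 0"
  by (simp add: level_def)

lemma level_last:
  assumes "0 < n"
  shows "level n \<rho> (n - 1) = card (bad n \<rho>)"
  unfolding level_def using bad_subset[of n \<rho>] by (simp add: inf.absorb1)

definition shape :: "nat \<Rightarrow> nat rel list \<Rightarrow> nat list" where
  "shape n \<rho> = map (\<lambda>i. card {x. x < n \<and> level n \<rho> x = i}) [0..<Suc (card (bad n \<rho>))]"

lemma nbox_nonempty_slice:
  assumes "\<forall>i<length v. 0 < v ! i" "i < length v"
  obtains a where "a \<in> nbox v" "blk a = i"
proof -
  have "card {b \<in> nbox v. blk b = i} > 0" using assms by (simp add: card_nbox_slice)
  then have "{b \<in> nbox v. blk b = i} \<noteq> {}" by (metis card.empty less_irrefl)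
  then show thesis using that by auto
qed

text \<open>The structure determines its canonical code. Along the order the block index starts at 0
  and rises by at most 1, and it rises exactly after bad positions; hence it coincides with the
  level.\<close>

lemma canonical_imp_template_shape:
  assumes v: "v \<noteq> []" "\<forall>i<length v. 0 < v ! i" and can: "canonical q v"
    and iso: "isomorphic (std n \<rho>) (inflate q (nbox v))"
    and \<rho>: "ordered_binary_structure k (std n \<rho>)"
  shows "template n \<rho> = q \<and> shape n \<rho> = v"
proof -
  obtain f where len: "length \<rho> = length q" and f: "bij_betw f {..<n} (nbox v)"
    and le0: "\<forall>x<n. \<forall>y<n. x \<le> y \<longleftrightarrow> f x \<in> nbox v \<and> f y \<in> nbox v \<and> lexle (f x) (f y)"
    and re0: "\<forall>i<length \<rho>. \<forall>x<n. \<forall>y<n.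
        (x, y) \<in> \<rho> ! i \<longleftrightarrow> f x \<in> nbox v \<and> f y \<in> nbox v \<and> key (f x) (f y) \<in> q ! i"
    using iso unfolding isomorphic_def by (auto simp: less_le_trans cong: conj_cong)
  have f_in: "f x \<in> nbox v" if "x < n" for x
    using f that by (auto simp: bij_betw_def)
  have f_onto: "\<exists>x<n. a = f x" if "a \<in> nbox v" for a
    using f that by (auto simp: bij_betw_def)
  have f_inj: "f x = f y \<longleftrightarrow> x = y" if "x < n" "y < n" for x y
    using f that by (auto simp: bij_betw_def inj_on_def)
  have le: "lexle (f x) (f y) \<longleftrightarrow> x \<le> y" if "x < n" "y < n" for x y
    using le0 f_in that by blast
  define b where "b x = blk (f x)" for x
  have key: "key (f x) (f y) = (b x, b y, x \<le> y, y \<le> x)" if "x < n" "y < n" for x y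
    using le that by (simp add: key_def b_def)
  have re: "(x, y) \<in> \<rho> ! i \<longleftrightarrow> (b x, b y, x \<le> y, y \<le> x) \<in> q ! i"
    if "i < length q" "x < n" "y < n" for i x y
    using re0 f_in key that len by metis
  have mono: "b x \<le> b y" if "x \<le> y" "y < n" for x y
    using le[of x y] that by (auto simp: b_def lexle_def)
  have b_less: "b x < length v" if "x < n" for x
    using f_in[OF that] by (simp add: b_def box_def)
  have b_onto: "\<exists>x<n. b x = i" if "i < length v" for i
    using nbox_nonempty_slice[OF v(2) that] f_onto b_def by metis
  have "0 < n" using b_onto[of 0] v(1) by auto
  have b_0: "b 0 = 0"
    using b_onto[of 0] mono[of 0] v(1) by fastforce
  \<comment> \<open>No block is empty, so none can be skipped.\<close>
  have b_Suc: "b (Suc x) = b x \<or> b (Suc x) = Suc (b x)" if "Suc x < n" for x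
  proof (rule ccontr)
    assume "\<not> ?thesis"
    then have less: "Suc (b x) < b (Suc x)" using mono[of x "Suc x"] that by simp
    then obtain y where y: "y < n" "b y = Suc (b x)"
      using b_onto[of "Suc (b x)"] b_less[OF \<open>Suc x < n\<close>] by auto
    show False
    proof (cases "y \<le> x")
      case True then show False using mono[of y x] y that by simp
    next
      case False then show False using mono[of "Suc x" y] y less by simp
    qed
  qed
  have not_bad: "x \<notin> bad n \<rho>" if "Suc x < n" "b (Suc x) = b x" for x
  proof
    assume "x \<in> bad n \<rho>"
    then obtain r where "r \<in> set \<rho>" and wit: "((x, x) \<in> r) \<noteq> ((Suc x, Suc x) \<in> r) \<or>
       (\<exists>z < n. z \<noteq> x \<and> z \<noteq> Suc x \<and>
        (((x, z) \<in> r) \<noteq> ((Suc x, z) \<in> r) \<or> ((z, x) \<in> r) \<noteq> ((z, Suc x) \<in> r)))"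
      by (auto simp: bad_def)
    then obtain i where i: "i < length q" "r = \<rho> ! i" using len by (auto simp: in_set_conv_nth)
    have "((x, x) \<in> r) = ((Suc x, Suc x) \<in> r)"
      using re[OF i(1)] i(2) that by simp
    then obtain z where z: "z < n" "z \<noteq> x" "z \<noteq> Suc x"
      and "((x, z) \<in> r) \<noteq> ((Suc x, z) \<in> r) \<or> ((z, x) \<in> r) \<noteq> ((z, Suc x) \<in> r)"
      using wit by blast
    moreover have "(x \<le> z) = (Suc x \<le> z)" "(z \<le> x) = (z \<le> Suc x)" using z by auto
    ultimately show False
      using re[OF i(1)] i(2) that by simp
  qed
  \<comment> \<open>The separating points \<open>a\<close> and \<open>c\<close> need not be the
    neighbours \<open>x\<close> and \<open>Suc x\<close>, but they lie in the same blocks, so with a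
    suitable third point the keys agree.\<close>
  have is_bad: "x \<in> bad n \<rho>" if x: "Suc x < n" "b (Suc x) = Suc (b x)" for x
  proof -
    have "separated q (nbox v) (b x)"
      using can b_less[OF x(1)] x(2) unfolding canonical_def by simp
    then obtain a c Q where ac: "a \<in> nbox v" "c \<in> nbox v" "blk a = b x" "blk c = Suc (b x)"
      and Q: "Q \<in> set q" and wit: "(key a a \<in> Q) \<noteq> (key c c \<in> Q) \<or>
     (\<exists>z \<in> nbox v. z \<noteq> a \<and> z \<noteq> c \<and> lexle z a = lexle z c \<and>
        ((key a z \<in> Q) \<noteq> (key c z \<in> Q) \<or> (key z a \<in> Q) \<noteq> (key z c \<in> Q)))"
      unfolding separated_def by blast
    obtain i where i: "i < length q" "Q = q ! i" using Q by (auto simp: in_set_conv_nth)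
    obtain p p' where p: "p < n" "a = f p" "p' < n" "c = f p'"
      using f_onto ac by metis
    have bp: "b p = b x" "b p' = Suc (b x)" using ac p by (simp_all add: b_def)
    have "p \<le> x" using mono[of "Suc x" p] p bp x by (cases "p \<le> x") auto
    have "Suc x \<le> p'" using mono[of p' x] p bp x by (cases "Suc x \<le> p'") auto
    have \<rho>i: "\<rho> ! i \<in> set \<rho>" using i len by simp
    show ?thesis
    proof (cases "(key a a \<in> Q) = (key c c \<in> Q)")
      case False
      then have "((x, x) \<in> \<rho> ! i) \<noteq> ((Suc x, Suc x) \<in> \<rho> ! i)"
        using re[OF i(1)] x p bp i(2) by (simp add: key)
      with x(1) \<rho>i show ?thesis unfolding bad_def by blast
    next
      case True
      then obtain z where z: "z \<in> nbox v" "z \<noteq> a" "z \<noteq> c" "lexle z a = lexle z c"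
        and zwit: "(key a z \<in> Q) \<noteq> (key c z \<in> Q) \<or> (key z a \<in> Q) \<noteq> (key z c \<in> Q)"
        using wit by blast
      obtain s where s: "s < n" "z = f s" using f_onto z by blast
      \<comment> \<open>As \<open>s\<close> lies on one side of both \<open>p\<close> and
        \<open>p'\<close>, and \<open>p \<le> x < Suc x \<le> p'\<close>, it is different from
        \<open>x\<close> and \<open>Suc x\<close> and compares with them as with \<open>p\<close>
        and \<open>p'\<close>.\<close>
      have "s \<noteq> p" "s \<noteq> p'" "(s \<le> p) = (s \<le> p')"
        using z s p le by auto
      then have "s < p \<or> p' < s" by auto
      then have s': "s < x \<or> Suc x < s" using \<open>p \<le> x\<close> \<open>Suc x \<le> p'\<close> by auto
      have ord: "(x \<le> s) = (p \<le> s)" "(s \<le> x) = (s \<le> p)"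
        "(Suc x \<le> s) = (p' \<le> s)" "(s \<le> Suc x) = (s \<le> p')"
        using \<open>s < p \<or> p' < s\<close> \<open>p \<le> x\<close> \<open>Suc x \<le> p'\<close> by auto
      have "((x, s) \<in> \<rho> ! i) = (key a z \<in> Q)" "((s, x) \<in> \<rho> ! i) = (key z a \<in> Q)"
        "((Suc x, s) \<in> \<rho> ! i) = (key c z \<in> Q)" "((s, Suc x) \<in> \<rho> ! i) = (key z c \<in> Q)"
        using re[OF i(1)] x s p bp i(2) ord by (simp_all add: key)
      then have "((x, s) \<in> \<rho> ! i) \<noteq> ((Suc x, s) \<in> \<rho> ! i) \<or> ((s, x) \<in> \<rho> ! i) \<noteq> ((s, Suc x) \<in> \<rho> ! i)"
        using zwit by simp
      moreover have "s \<noteq> x" "s \<noteq> Suc x" using s' by auto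
      ultimately show ?thesis using x(1) \<rho>i s(1) unfolding bad_def by blast
    qed
  qed
  have level: "level n \<rho> x = b x" if "x < n" for x
    using that
  proof (induction x)
    case 0 then show ?case by (simp add: b_0)
  next
    case (Suc x)
    then show ?case
      using b_Suc[OF Suc.prems] not_bad[OF Suc.prems] is_bad[OF Suc.prems] by (auto simp: level_Suc)
  qed
  have "length v = Suc (card (bad n \<rho>))"
  proof -
    have "b (n - 1) = length v - 1"
    proof (rule antisym)
      show "b (n - 1) \<le> length v - 1" using b_less[of "n - 1"] \<open>0 < n\<close> by simp
      obtain x where "x < n" "b x = length v - 1" using b_onto[of "length v - 1"] v(1) by auto
      then show "length v - 1 \<le> b (n - 1)" using mono[of x "n - 1"] by simp
    qed
    then show ?thesis using level[of "n - 1"] level_last[OF \<open>0 < n\<close>] \<open>0 < n\<close> v(1) by simp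
  qed
  moreover have "card {x. x < n \<and> level n \<rho> x = i} = v ! i" if "i < length v" for i
  proof -
    have "{x. x < n \<and> level n \<rho> x = i} = {x. x < n \<and> blk (f x) = i}"
      using level by (auto simp: b_def)
    then show ?thesis
      using card_fibre_bij[OF f, of blk i] card_nbox_slice[OF that] by simp
  qed
  ultimately have "shape n \<rho> = v"
    by (simp add: shape_def list_eq_iff_nth_eq del: upt_Suc)
  moreover have "level_key n \<rho> ` (\<rho> ! i) = q ! i" if i: "i < length q" for i
  proof (intro equalityI subsetI)
    fix \<kappa> assume "\<kappa> \<in> level_key n \<rho> ` (\<rho> ! i)"
    then obtain x y where xy: "(x, y) \<in> \<rho> ! i" "\<kappa> = level_key n \<rho> (x, y)" by auto
    moreover have "x < n" "y < n"
      using xy(1) \<rho> i len nth_mem[of i \<rho>] by (auto simp: ordered_binary_structure_std_iff)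
    ultimately show "\<kappa> \<in> q ! i" using re[OF i] level by (simp add: level_key_def)
  next
    fix \<kappa> assume \<kappa>: "\<kappa> \<in> q ! i"
    then obtain a c where "a \<in> nbox v" "c \<in> nbox v" "\<kappa> = key a c"
      using can i nth_mem[of i q] unfolding canonical_def by blast
    then obtain x y where xy: "x < n" "y < n" "\<kappa> = key (f x) (f y)" using f_onto by metis
    then have "(x, y) \<in> \<rho> ! i" using re[OF i] \<kappa> by (simp add: key)
    moreover have "\<kappa> = level_key n \<rho> (x, y)" using xy by (simp add: key level_key_def level)
    ultimately show "\<kappa> \<in> level_key n \<rho> ` (\<rho> ! i)" by blast
  qed
  then have "template n \<rho> = q"
    using len by (simp add: template_def list_eq_iff_nth_eq)
  ultimately show ?thesis by blast
qed

text \<open>Take the first place where the level exceeds \<open>i\<close>; the position just before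
  it is bad and has level \<open>i\<close>.\<close>

lemma exists_bad_level:
  assumes "i < card (bad n \<rho>)"
  obtains x where "x \<in> bad n \<rho>" "level n \<rho> x = i"
proof -
  have "0 < n" using assms bad_subset[of n \<rho>] by (cases n) auto
  then have ex: "\<exists>x. i < level n \<rho> x" using assms level_last by metis
  define y where "y = (LEAST x. i < level n \<rho> x)"
  have y: "i < level n \<rho> y" unfolding y_def using ex by (rule LeastI_ex)
  then obtain x where x: "y = Suc x" by (cases y) auto
  have "\<not> i < level n \<rho> x" using not_less_Least[of x "\<lambda>x. i < level n \<rho> x"] x y_def by simp
  with y x have "x \<in> bad n \<rho> \<and> level n \<rho> x = i"
    by (auto simp: level_Suc split: if_splits)
  then show thesis using that by blast
qed

lemma finite_placement [simp]: "finite (placement n \<rho>)"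
  by (simp add: placement_def)

lemma shape_eq_sizes: "shape n \<rho> = sizes (Suc (card (bad n \<rho>))) (placement n \<rho>)"
proof -
  have "{b \<in> placement n \<rho>. blk b = i} =
      (\<lambda>x. prod_encode (level n \<rho> x, x)) ` {x. x < n \<and> level n \<rho> x = i}" for i
    by (auto simp: placement_def)
  then show ?thesis
    unfolding shape_def sizes_def by (simp add: card_image inj_on_def del: upt_Suc)
qed

lemma sum_list_shape: "sum_list (shape n \<rho>) = n"
proof -
  have "card (placement n \<rho>) = card (nbox (shape n \<rho>))"
    unfolding shape_eq_sizes
    by (rule card_eq_if_card_fibres_eq[OF finite_placement finite_nbox
          card_slice_sizes[OF blk_placement[OF lessI]]])
  then show ?thesis
    by (simp add: card_nbox placement_def card_image inj_on_def)
qed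

lemma length_shape [simp]: "length (shape n \<rho>) = Suc (card (bad n \<rho>))"
  by (simp add: shape_def)

text \<open>Each level but the top one contains the bad position that ends it; the top one contains
  the last point \<open>n - 1\<close>.\<close>

lemma shape_pos:
  assumes "0 < n" "i < length (shape n \<rho>)"
  shows "0 < shape n \<rho> ! i"
proof -
  have "\<exists>x<n. level n \<rho> x = i"
  proof (cases "i = card (bad n \<rho>)")
    case True
    then show ?thesis using level_last[OF assms(1)] assms(1) by (intro exI[of _ "n - 1"]) simp
  next
    case False
    then have "i < card (bad n \<rho>)" using assms(2) by simp
    then obtain x where "x \<in> bad n \<rho>" "level n \<rho> x = i" by (rule exists_bad_level)
    then show ?thesis by (intro exI[of _ x]) (auto simp: bad_def)
  qed
  then have "{x. x < n \<and> level n \<rho> x = i} \<noteq> {}" by auto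
  then have "0 < card {x. x < n \<and> level n \<rho> x = i}" by (simp add: card_gt_0_iff)
  then show ?thesis using assms(2) by (simp add: shape_def del: upt_Suc)
qed

lemma isomorphic_inflate_shape:
  assumes "ordered_binary_structure k (std n \<rho>)"
  shows "isomorphic (std n \<rho>) (inflate (template n \<rho>) (nbox (shape n \<rho>)))"
  unfolding shape_eq_sizes
  by (rule isomorphic_trans[OF isomorphic_inflate_template[OF assms]
        isomorphic_inflate_nbox_sizes[OF finite_placement blk_placement[OF lessI]]])

text \<open>Every key of the template is the key of an actual pair, and consecutive levels are
  separated by the bad position between them together with its witness.\<close>

lemma canonical_template_shape:
  assumes \<rho>: "ordered_binary_structure k (std n \<rho>)"
  shows "canonical (template n \<rho>) (shape n \<rho>)"
proof -
  obtain g where g: "bij_betw g (placement n \<rho>) (nbox (shape n \<rho>))"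
    and gk: "\<And>a b. a \<in> placement n \<rho> \<Longrightarrow> b \<in> placement n \<rho> \<Longrightarrow> key (g a) (g b) = key a b"
    unfolding shape_eq_sizes
    by (rule key_bijection_exists[OF finite_placement finite_nbox
          card_slice_sizes[OF blk_placement[OF lessI]]]) blast
  \<comment> \<open>The point of the compressed box that represents \<open>x\<close>.\<close>
  define e where "e x = g (prod_encode (level n \<rho> x, x))" for x
  have e_in: "e x \<in> nbox (shape n \<rho>)" if "x < n" for x
    unfolding e_def using bij_betwE[OF g] that by (simp add: placement_def)
  have e_key: "key (e x) (e y) = level_key n \<rho> (x, y)" if "x < n" "y < n" for x y
    unfolding e_def using that by (simp add: gk placement_def key_placement)
  have e_neq: "e x \<noteq> e y" if "x < n" "y < n" "x \<noteq> y" for x y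
  proof
    assume "e x = e y"
    then have "level_key n \<rho> (x, y) = level_key n \<rho> (x, x)"
      using e_key[OF that(1,2)] e_key[OF that(1,1)] by simp
    then show False using that(3) by (simp add: level_key_def)
  qed
  have e_blk: "blk (e x) = level n \<rho> x" and e_le: "lexle (e x) (e y) \<longleftrightarrow> x \<le> y"
    if "x < n" "y < n" for x y
    using e_key[OF that] by (simp_all add: key_def level_key_def)
  show ?thesis
    unfolding canonical_def
  proof (intro conjI ballI allI impI)
    fix Q \<kappa> assume "Q \<in> set (template n \<rho>)" "\<kappa> \<in> Q"
    then obtain r x y where "r \<in> set \<rho>" "(x, y) \<in> r" "\<kappa> = level_key n \<rho> (x, y)"
      by (auto simp: template_def)
    moreover have "x < n" "y < n"
      using calculation \<rho> by (auto simp: ordered_binary_structure_std_iff)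
    ultimately show "\<exists>a \<in> nbox (shape n \<rho>). \<exists>b \<in> nbox (shape n \<rho>). \<kappa> = key a b"
      using e_in e_key by metis
  next
    fix i assume "Suc i < length (shape n \<rho>)"
    then have "i < card (bad n \<rho>)" by simp
    then obtain x where x: "x \<in> bad n \<rho>" "level n \<rho> x = i" by (rule exists_bad_level)
    then have n: "x < n" "Suc x < n" by (auto simp: bad_def)
    obtain r where r: "r \<in> set \<rho>" and wit: "((x, x) \<in> r) \<noteq> ((Suc x, Suc x) \<in> r) \<or>
       (\<exists>z < n. z \<noteq> x \<and> z \<noteq> Suc x \<and>
        (((x, z) \<in> r) \<noteq> ((Suc x, z) \<in> r) \<or> ((z, x) \<in> r) \<noteq> ((z, Suc x) \<in> r)))"
      using x by (auto simp: bad_def)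
    define Q where "Q = level_key n \<rho> ` r"
    have Q: "Q \<in> set (template n \<rho>)" using r by (auto simp: Q_def template_def)
    have key_iff: "key (e y) (e z) \<in> Q \<longleftrightarrow> (y, z) \<in> r" if "y < n" "z < n" for y z
      unfolding Q_def using level_key_iff[OF \<rho> r that] e_key[OF that] by simp
    have "(key (e x) (e x) \<in> Q) \<noteq> (key (e (Suc x)) (e (Suc x)) \<in> Q) \<or>
     (\<exists>z \<in> nbox (shape n \<rho>). z \<noteq> e x \<and> z \<noteq> e (Suc x) \<and> lexle z (e x) = lexle z (e (Suc x)) \<and>
        ((key (e x) z \<in> Q) \<noteq> (key (e (Suc x)) z \<in> Q) \<or> (key z (e x) \<in> Q) \<noteq> (key z (e (Suc x)) \<in> Q)))"
    proof (cases "((x, x) \<in> r) = ((Suc x, Suc x) \<in> r)")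
      case False
      then show ?thesis using key_iff n by simp
    next
      case True
      then obtain z where z: "z < n" "z \<noteq> x" "z \<noteq> Suc x"
        "((x, z) \<in> r) \<noteq> ((Suc x, z) \<in> r) \<or> ((z, x) \<in> r) \<noteq> ((z, Suc x) \<in> r)"
        using wit by blast
      have "lexle (e z) (e x) = lexle (e z) (e (Suc x))"
        using z(1-3) n e_le by auto
      moreover have "(key (e x) (e z) \<in> Q) \<noteq> (key (e (Suc x)) (e z) \<in> Q) \<or>
          (key (e z) (e x) \<in> Q) \<noteq> (key (e z) (e (Suc x)) \<in> Q)"
        using z(4) key_iff z(1) n by simp
      ultimately show ?thesis
        using z(1-3) n e_in e_neq by blast
    qed
    moreover have "blk (e x) = i" "blk (e (Suc x)) = Suc i"
      using e_blk n x by (auto simp: level_Suc)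
    ultimately show "separated (template n \<rho>) (nbox (shape n \<rho>)) i"
      unfolding separated_def using e_in n Q by blast
  qed
qed

text \<open>Empty blocks are excluded, so \<open>m\<close> is the true number of blocks and varies
  over the class, unlike in the union of ages.\<close>

definition canonical_codes :: "nat ordbin set \<Rightarrow> nat \<Rightarrow> key set list \<Rightarrow> nat \<Rightarrow> nat list set" where
  "canonical_codes C m q n =
     {v \<in> codes C m q. (\<forall>i<m. 0 < v ! i) \<and> sum_list v = n \<and> canonical q v}"

lemma finite_canonical_codes: "finite (canonical_codes C m q n)"
  by (rule finite_subset[OF _ finite_lists_sum[of "codes C m q" m n]])
    (auto simp: canonical_codes_def codes_def)

text \<open>Writing a positive vector as \<open>map Suc u\<close> turns the codes into a downset
  \<open>D\<close> of vectors \<open>u\<close>. Its non-canonical part \<open>D'\<close> is again a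
  downset since canonicity passes upwards; the count is a difference, shifted by \<open>m\<close>
  because each of the \<open>m\<close> entries loses 1.\<close>

lemma evpoly_canonical_codes:
  assumes C: "hereditary_class k C"
  shows "evpoly (\<lambda>n. real (card (canonical_codes C m q n)))"
proof -
  define D where "D = {u. map Suc u \<in> codes C m q}"
  define D' where "D' = {u \<in> D. \<not> canonical q (map Suc u)}"
  have Suc_le: "list_all2 (\<le>) (map Suc u) (map Suc w)" if "list_all2 (\<le>) u w" for u w
    using that by (simp add: list_all2_map1 list_all2_map2)
  have D: "downset m D"
    using downset_codes[OF C, of m q] Suc_le unfolding downset_def D_def by fastforce
  have D': "downset m D'"
    using D canonical_mono[OF _ Suc_le] unfolding downset_def D'_def by blast
  have fin: "finite {u \<in> D. sum_list u = n}" for n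
    using D by (intro finite_lists_sum) (auto simp: downset_def)
  have "evpoly (\<lambda>n. real (card {u \<in> D. sum_list u = n - m}) - real (card {u \<in> D'. sum_list u = n - m}))"
    by (intro evpoly_diff evpoly_shift[OF evpoly_downset_count[OF D]]
        evpoly_shift[OF evpoly_downset_count[OF D']])
  then show ?thesis
  proof (rule evpoly_cong)
    fix n assume n: "m \<le> n"
    have sum: "sum_list (map Suc u) = sum_list u + length u" for u
      by (induction u) auto
    have len: "length u = m" if "u \<in> D" for u using D that by (auto simp: downset_def)
    have "canonical_codes C m q n = map Suc ` ({u \<in> D. sum_list u = n - m} - {u \<in> D'. sum_list u = n - m})"
    proof (intro equalityI subsetI)
      fix v assume v: "v \<in> canonical_codes C m q n"
      then have "map Suc (map (\<lambda>x. x - 1) v) = v"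
        by (auto simp: canonical_codes_def codes_def intro!: nth_equalityI)
      moreover have "map (\<lambda>x. x - 1) v \<in> D"
        using v calculation by (simp add: D_def canonical_codes_def)
      ultimately show "v \<in> map Suc ` ({u \<in> D. sum_list u = n - m} - {u \<in> D'. sum_list u = n - m})"
        using v len sum[of "map (\<lambda>x. x - 1) v"]
        by (intro image_eqI[of _ _ "map (\<lambda>x. x - 1) v"]) (auto simp: canonical_codes_def codes_def D'_def)
    next
      fix v assume "v \<in> map Suc ` ({u \<in> D. sum_list u = n - m} - {u \<in> D'. sum_list u = n - m})"
      then obtain u where u: "v = map Suc u" "u \<in> D" "sum_list u = n - m" "canonical q v"
        by (auto simp: D'_def)
      then show "v \<in> canonical_codes C m q n"
        using n len[OF u(2)] sum[of u] by (auto simp: canonical_codes_def D_def)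
    qed
    then have "card (canonical_codes C m q n) =
        card ({u \<in> D. sum_list u = n - m} - {u \<in> D'. sum_list u = n - m})"
      by (simp add: card_image inj_on_def)
    also have "\<dots> = card {u \<in> D. sum_list u = n - m} - card {u \<in> D'. sum_list u = n - m}"
      by (rule card_Diff_subset) (auto simp: D'_def intro: finite_subset[OF _ fin])
    also have "real \<dots> = real (card {u \<in> D. sum_list u = n - m}) - real (card {u \<in> D'. sum_list u = n - m})"
      by (rule of_nat_diff) (auto simp: D'_def intro: card_mono[OF fin])
    finally show "real (card (canonical_codes C m q n)) =
      real (card {u \<in> D. sum_list u = n - m}) - real (card {u \<in> D'. sum_list u = n - m})" .
  qed
qed

text \<open>Template and shape form a bijection onto canonical codes. The empty structure is left
  out because its shape is \<open>[0]\<close>, with an empty block.\<close>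

lemma profile_eq_sum_canonical_codes:
  assumes C: "hereditary_class k C" and bad: "\<And>n \<rho>. std n \<rho> \<in> C \<Longrightarrow> card (bad n \<rho>) < M"
    and n: "0 < n"
  shows "profile C n = (\<Sum>(m, q) \<in> Sigma {1..M} (templates k). card (canonical_codes C m q n))"
proof -
  define X where "X = (\<Union>(m, q) \<in> Sigma {1..M} (templates k). Pair q ` canonical_codes C m q n)"
  have "bij_betw (\<lambda>\<rho>. (template n \<rho>, shape n \<rho>)) {\<rho>. std n \<rho> \<in> C} X"
  proof (rule bij_betwI')
    fix \<rho> \<rho>' assume mem: "\<rho> \<in> {\<rho>. std n \<rho> \<in> C}" "\<rho>' \<in> {\<rho>. std n \<rho> \<in> C}"
    have obs: "ordered_binary_structure k (std n \<rho>)" "ordered_binary_structure k (std n \<rho>')"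
      using mem hereditary_classD[OF C] by auto
    show "(template n \<rho>, shape n \<rho>) = (template n \<rho>', shape n \<rho>') \<longleftrightarrow> \<rho> = \<rho>'"
    proof
      assume "(template n \<rho>, shape n \<rho>) = (template n \<rho>', shape n \<rho>')"
      then have "isomorphic (std n \<rho>) (std n \<rho>')"
        using isomorphic_trans[OF isomorphic_inflate_shape[OF obs(1)]]
          isomorphic_sym[OF isomorphic_inflate_shape[OF obs(2)]] by simp
      then show "\<rho> = \<rho>'" using isomorphic_std_imp_eq[OF obs] by blast
    qed simp
  next
    fix \<rho> assume "\<rho> \<in> {\<rho>. std n \<rho> \<in> C}"
    then have mem: "std n \<rho> \<in> C" and obs: "ordered_binary_structure k (std n \<rho>)"
      using hereditary_classD[OF C] by auto
    let ?m = "Suc (card (bad n \<rho>))"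
    have t: "template n \<rho> \<in> templates k ?m"
      using template_in_templates[OF obs lessI] .
    have "inflate (template n \<rho>) (nbox (shape n \<rho>)) \<in> C"
      using hereditary_class_isomorphic[OF C mem _ isomorphic_inflate_shape[OF obs]]
        ordered_binary_structure_inflate t by (auto simp: templates_def)
    then have "shape n \<rho> \<in> canonical_codes C ?m (template n \<rho>) n"
      using shape_pos[OF n] sum_list_shape canonical_template_shape[OF obs]
      by (simp add: canonical_codes_def codes_def)
    moreover have "?m \<in> {1..M}" using bad[OF mem] by simp
    ultimately show "(template n \<rho>, shape n \<rho>) \<in> X"
      unfolding X_def using t by blast
  next
    fix c assume "c \<in> X"
    then obtain m q v where c: "c = (q, v)" "m \<in> {1..M}" "q \<in> templates k m"
      "v \<in> canonical_codes C m q n"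
      by (auto simp: X_def)
    then have v: "inflate q (nbox v) \<in> C" "\<forall>i<length v. 0 < v ! i" "v \<noteq> []" "canonical q v"
      "sum_list v = n"
      by (auto simp: canonical_codes_def codes_def)
    obtain \<rho> where \<rho>: "isomorphic (std n \<rho>) (inflate q (nbox v))" "std n \<rho> \<in> C"
      using hereditary_class_std_exists[OF C v(1)] card_nbox[of v] v(5) by auto
    have "template n \<rho> = q \<and> shape n \<rho> = v"
      using canonical_imp_template_shape[OF v(3,2,4) \<rho>(1)] hereditary_classD(1)[OF C \<rho>(2)] by blast
    with c \<rho> show "\<exists>\<rho> \<in> {\<rho>. std n \<rho> \<in> C}. c = (template n \<rho>, shape n \<rho>)" by auto
  qed
  then have "profile C n = card X"
    by (simp add: profile_eq_card_std[OF C] bij_betw_same_card)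
  also have "\<dots> = (\<Sum>(m, q) \<in> Sigma {1..M} (templates k). card (Pair q ` canonical_codes C m q n))"
    unfolding X_def
  proof (subst card_UN_disjoint)
    show "finite (Sigma {1..M} (templates k))"
      using finite_templates by (intro finite_SigmaI) auto
    show "\<forall>i\<in>Sigma {1..M} (templates k). finite (case i of (m, q) \<Rightarrow> Pair q ` canonical_codes C m q n)"
      using finite_canonical_codes by auto
    \<comment> \<open>Different indices cannot share a pair: \<open>q\<close> is its first component
      and \<open>m\<close> is the length of its second.\<close>
    show "\<forall>i\<in>Sigma {1..M} (templates k). \<forall>j\<in>Sigma {1..M} (templates k). i \<noteq> j \<longrightarrow>
      (case i of (m, q) \<Rightarrow> Pair q ` canonical_codes C m q n) \<inter>
      (case j of (m, q) \<Rightarrow> Pair q ` canonical_codes C m q n) = {}"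
      by (auto simp: canonical_codes_def codes_def)
  qed (simp add: case_prod_unfold)
  also have "\<dots> = (\<Sum>(m, q) \<in> Sigma {1..M} (templates k). card (canonical_codes C m q n))"
    by (intro sum.cong) (auto simp: card_image inj_on_def)
  finally show ?thesis .
qed

lemma eventually_polynomial_profile:
  assumes C: "hereditary_class k C" and bad: "\<And>n \<rho>. std n \<rho> \<in> C \<Longrightarrow> card (bad n \<rho>) < M"
  shows "eventually_polynomial (profile C)"
proof -
  have "evpoly (\<lambda>n. \<Sum>i \<in> Sigma {1..M} (templates k). real (card (canonical_codes C (fst i) (snd i) n)))"
    by (intro evpoly_sum evpoly_canonical_codes[OF C])
  then have "evpoly (\<lambda>n. real (profile C n))"
  proof (rule evpoly_cong)
    fix n :: nat assume "1 \<le> n"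
    then show "real (profile C n) =
        (\<Sum>i \<in> Sigma {1..M} (templates k). real (card (canonical_codes C (fst i) (snd i) n)))"
      using profile_eq_sum_canonical_codes[OF C bad, of n] by (simp add: case_prod_unfold)
  qed
  then show ?thesis unfolding eventually_polynomial_def evpoly_def .
qed

theorem theorem8p30:
  fixes k :: nat and C :: "nat ordbin set"
  assumes "hereditary_class k C"
  shows "((\<exists>l. \<forall>R \<in> C. has_monomorphic_decomposition_le R (l + 1)) \<or>
            at_least_exponential (profile C)) \<and>
         (\<forall>l. (\<forall>R \<in> C. has_monomorphic_decomposition_le R (l + 1)) \<longrightarrow>
            (\<exists>F. finite F \<and>
                 (\<forall>S \<in> F. ordered_binary_structure k S \<and>
                    has_monomorphic_decomposition_le S (l + 1)) \<and>
                 C = (\<Union>S \<in> F. age k S)) \<and>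
            eventually_polynomial (profile C))"
proof (intro conjI allI impI)
  show "(\<exists>l. \<forall>R \<in> C. has_monomorphic_decomposition_le R (l + 1)) \<or>
            at_least_exponential (profile C)"
  proof (cases "\<forall>L. \<exists>n \<rho>. std n \<rho> \<in> C \<and> L \<le> card (bad n \<rho>)")
    case True
    then show ?thesis using bad_unbounded_imp_exponential[OF assms] by blast
  next
    case False
    then obtain L where "\<And>n \<rho>. std n \<rho> \<in> C \<Longrightarrow> card (bad n \<rho>) < L + 1"
      by (metis less_add_one not_le order_less_trans)
    then show ?thesis using has_monomorphic_decomposition_le_if_bad[OF assms] by blast
  qed
next
  fix l assume l: "\<forall>R \<in> C. has_monomorphic_decomposition_le R (l + 1)"
  obtain L where "\<And>n \<rho>. std n \<rho> \<in> C \<Longrightarrow> card (bad n \<rho>) \<le> L"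
    using bad_bounded_if_decomposition_bounded[OF assms l] by blast
  then have L: "card (bad n \<rho>) < Suc L" if "std n \<rho> \<in> C" for n \<rho>
    using that by (simp add: less_Suc_eq_le)
  show "eventually_polynomial (profile C)"
    using eventually_polynomial_profile[OF assms L] .
  obtain F where F: "finite F" "\<forall>S \<in> F. ordered_binary_structure k S" "C = (\<Union>S \<in> F. age k S)"
    using hereditary_class_finite_union_of_ages[OF assms L] by blast
  \<comment> \<open>The age of \<open>S\<close> is contained in \<open>C\<close>, so its members
    have the decompositions assumed for \<open>C\<close>; this replaces the weaker bound that the
    construction of \<open>S\<close> would give.\<close>
  have "has_monomorphic_decomposition_le S (l + 1)" if "S \<in> F" for S
    using has_monomorphic_decomposition_le_if_age[of k S "l + 1"] F l that by blast
  with F show "\<exists>F. finite F \<and> (\<forall>S \<in> F. ordered_binary_structure k S \<and>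
      has_monomorphic_decomposition_le S (l + 1)) \<and> C = (\<Union>S \<in> F. age k S)"
    by blast
qed

end
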